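(* Let $\Pi=\mathbb{R}/\mathbb{Z}$ be the circle. Let $a\in C^2(\Pi)$ with $a>0$ and $b\in C^1(\Pi)$. Assume that $b$ changes sign on $\Pi$ (it takes both positive and negative values), that $b$ vanishes at only finitely many points $x_1,\dots,x_n$, and that each zero $x_i$ of $b$ is either of finite order $m_i\ge1$ or flat. Then for all $a_1,\dots,a_n\ge0$ with $\sum_{i=1}^n a_i=1$, $$J\Bigl(\sum_{i=1}^n a_i\,\delta_{x_i}\Bigr)=\sum_{i=1}^n a_i\,\max(0,b'(x_i)).$$
   Context: A zero $x_i$ of $b$ is of finite order $m_i\ge1$ if $b$ is $C^{m_i}$ in a neighborhood of $x_i$, $b(x_i)=\dots=b^{(m_i-1)}(x_i)=0$ and $b^{(m_i)}(x_i)\ne0$. It is flat if $b$ is $C^\infty$ in a neighborhood of $x_i$ and $b^{(k)}(x_i)=0$ for all $k\in\mathbb{N}$. For $c\in C^0(\Pi)$ and $\epsilon>0$, let $\lambda_\epsilon^c$ be the principal eigenvalue (the eigenvalue with maximal real part) of the operator $u\mapsto\epsilon\,a\,u''+b\,u'+c\,u$ on $\Pi$. Let $\Lambda(c):=\lim_{\epsilon\to0}\lambda_\epsilon^c$ (this limit exists under the present assumptions). For a probability measure $\mu$ on $\Pi$, $$J(\mu):=\sup_{c\in C^0(\Pi)}\Bigl\{\int_\Pi c\,d\mu-\Lambda(c)\Bigr\}.$$ *)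

theory Defs
  imports "HOL-Probability.Probability"
begin

(* Functions on the circle R/Z are represented by their 1-periodic lifts to the real line, and
   points of the circle by their representatives in [0,1). *)
definition periodic :: "(real \<Rightarrow> 'a) \<Rightarrow> bool" where
  "periodic f \<longleftrightarrow> (\<forall>t. f (t + 1) = f t)"

definition nderiv :: "nat \<Rightarrow> (real \<Rightarrow> 'a::real_normed_vector) \<Rightarrow> real \<Rightarrow> 'a" where
  "nderiv k f = ((\<lambda>g t. vector_derivative g (at t)) ^^ k) f"

(* Only meant for open S, since derivatives are taken at t rather than at t within S. *)
definition Ck_on :: "nat \<Rightarrow> real set \<Rightarrow> (real \<Rightarrow> 'a::real_normed_vector) \<Rightarrow> bool" where
  "Ck_on k S f \<longleftrightarrow>
     (\<forall>j<k. \<forall>t\<in>S. nderiv j f differentiable (at t)) \<and> continuous_on S (nderiv k f)"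

definition Ck_circle :: "nat \<Rightarrow> (real \<Rightarrow> 'a::real_normed_vector) set" where
  "Ck_circle k = {f. periodic f \<and> Ck_on k UNIV f}"

definition finite_order_zero :: "(real \<Rightarrow> real) \<Rightarrow> nat \<Rightarrow> real \<Rightarrow> bool" where
  "finite_order_zero b m p \<longleftrightarrow>
     1 \<le> m \<and> (\<exists>S. open S \<and> p \<in> S \<and> Ck_on m S b) \<and>
     (\<forall>j<m. nderiv j b p = 0) \<and> nderiv m b p \<noteq> 0"

definition flat_zero :: "(real \<Rightarrow> real) \<Rightarrow> real \<Rightarrow> bool" where
  "flat_zero b p \<longleftrightarrow>
     (\<exists>S. open S \<and> p \<in> S \<and> (\<forall>k. Ck_on k S b)) \<and> (\<forall>k. nderiv k b p = 0)"

definition is_eigenvalue ::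
  "(real \<Rightarrow> real) \<Rightarrow> (real \<Rightarrow> real) \<Rightarrow> (real \<Rightarrow> real) \<Rightarrow> real \<Rightarrow> complex \<Rightarrow> bool" where
  "is_eigenvalue a b c \<epsilon> z \<longleftrightarrow>
     (\<exists>u::real \<Rightarrow> complex. u \<in> Ck_circle 2 \<and> (\<exists>t. u t \<noteq> 0) \<and>
        (\<forall>t. (\<epsilon> * a t) *\<^sub>R nderiv 2 u t + b t *\<^sub>R nderiv 1 u t + c t *\<^sub>R u t = z * u t))"

(* By Krein-Rutman there is exactly one eigenvalue of maximal real part and it is real, so THE is
   well defined and Re only changes its type. *)
definition principal_eigenvalue ::
  "(real \<Rightarrow> real) \<Rightarrow> (real \<Rightarrow> real) \<Rightarrow> (real \<Rightarrow> real) \<Rightarrow> real \<Rightarrow> real" where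
  "principal_eigenvalue a b c \<epsilon> =
     Re (THE z. is_eigenvalue a b c \<epsilon> z \<and> (\<forall>z'. is_eigenvalue a b c \<epsilon> z' \<longrightarrow> Re z' \<le> Re z))"

definition limit_eigenvalue ::
  "(real \<Rightarrow> real) \<Rightarrow> (real \<Rightarrow> real) \<Rightarrow> (real \<Rightarrow> real) \<Rightarrow> real" where
  "limit_eigenvalue a b c = Lim (at_right 0) (principal_eigenvalue a b c)"

(* The projection [0,1) \<rightarrow> R/Z is a Borel isomorphism (though not a homeomorphism), so this is the
   Borel sigma-algebra of the circle. *)
definition circle_borel :: "real measure" where
  "circle_borel = restrict_space borel {0..<1}"

(* The supremum is taken in the extended reals, where it always exists. *)
definition J :: "(real \<Rightarrow> real) \<Rightarrow> (real \<Rightarrow> real) \<Rightarrow> real measure \<Rightarrow> ereal" where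
  "J a b \<mu> = (SUP c \<in> Ck_circle 0. ereal ((\<integral>t. c t \<partial>\<mu>) - limit_eigenvalue a b c))"

definition dirac_sum :: "nat \<Rightarrow> (nat \<Rightarrow> real) \<Rightarrow> (nat \<Rightarrow> real) \<Rightarrow> real measure" where
  "dirac_sum n w x =
     measure_of (space circle_borel) (sets circle_borel)
       (\<lambda>A. \<Sum>i=1..n. ennreal (w i) * emeasure (return circle_borel (x i)) A)"

lemma space_dirac_sum: "space (dirac_sum n w x) = {0..<1}"
  and sets_dirac_sum: "sets (dirac_sum n w x) = sets circle_borel"
proof -
  show "space (dirac_sum n w x) = {0..<1}"
    unfolding dirac_sum_def by (simp add: space_measure_of_conv circle_borel_def space_restrict_space)
  show "sets (dirac_sum n w x) = sets circle_borel"
    unfolding dirac_sum_def by simp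
qed

lemma emeasure_dirac_sum:
  assumes "A \<in> sets circle_borel"
  shows "emeasure (dirac_sum n w x) A =
    (\<Sum>i=1..n. ennreal (w i) * emeasure (return circle_borel (x i)) A)"
proof (rule emeasure_measure_of[OF dirac_sum_def])
  show "sets circle_borel \<subseteq> Pow (space circle_borel)"
    by (rule sets.space_closed)
  show "A \<in> sets (dirac_sum n w x)"
    using assms by (simp add: sets_dirac_sum)
  show "positive (sets (dirac_sum n w x))
     (\<lambda>A. \<Sum>i=1..n. ennreal (w i) * emeasure (return circle_borel (x i)) A)"
    by (simp add: positive_def)
  show "countably_additive (sets (dirac_sum n w x))
     (\<lambda>A. \<Sum>i=1..n. ennreal (w i) * emeasure (return circle_borel (x i)) A)"
  proof (rule countably_additiveI)
    fix F :: "nat \<Rightarrow> real set"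
    assume F: "range F \<subseteq> sets (dirac_sum n w x)" "disjoint_family F"
    have "(\<Sum>k. \<Sum>i=1..n. ennreal (w i) * emeasure (return circle_borel (x i)) (F k)) =
        (\<Sum>i=1..n. \<Sum>k. ennreal (w i) * emeasure (return circle_borel (x i)) (F k))"
      by (rule suminf_sum) simp
    also have "\<dots> = (\<Sum>i=1..n. ennreal (w i) * emeasure (return circle_borel (x i)) (\<Union>k. F k))"
      using F by (intro sum.cong refl, subst ennreal_suminf_cmult, subst suminf_emeasure)
        (simp_all add: sets_dirac_sum)
    finally show "(\<Sum>k. \<Sum>i=1..n. ennreal (w i) * emeasure (return circle_borel (x i)) (F k)) =
        (\<Sum>i=1..n. ennreal (w i) * emeasure (return circle_borel (x i)) (\<Union>k. F k))" .
  qed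
qed

lemma prob_space_dirac_sum:
  assumes x: "\<And>i. i \<in> {1..n} \<Longrightarrow> x i \<in> {0..<1}"
    and w: "\<And>i. i \<in> {1..n} \<Longrightarrow> 0 \<le> w i" "(\<Sum>i=1..n. w i) = 1"
  shows "prob_space (dirac_sum n w x)"
proof
  have sp: "space circle_borel = {0..<1::real}"
    by (simp add: circle_borel_def space_restrict_space)
  have "emeasure (dirac_sum n w x) (space (dirac_sum n w x)) =
      (\<Sum>i=1..n. ennreal (w i) * emeasure (return circle_borel (x i)) (space circle_borel))"
    by (simp add: space_dirac_sum emeasure_dirac_sum flip: sp)
  also have "\<dots> = (\<Sum>i=1..n. ennreal (w i))"
    using x by (intro sum.cong refl) (simp add: sp[symmetric])
  also have "\<dots> = 1"
    using w by (subst sum_ennreal) auto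
  finally show "emeasure (dirac_sum n w x) (space (dirac_sum n w x)) = 1" .
qed

end

theory Submission
  imports Defs "HOL-Complex_Analysis.Great_Picard"
begin

text \<open>
  Everything follows from
  \<open>\<Lambda>(c) = max\<^sub>i (c(x\<^sub>i) - max(0, b'(x\<^sub>i)))\<close>: then \<open>\<Lambda>(c)\<close> dominates the average of
  \<open>c(x\<^sub>i) - max(0, b'(x\<^sub>i))\<close> with weights \<open>a\<^sub>i\<close>, with equality for \<open>c = max(0, b')\<close>.

  For fixed \<open>\<epsilon>\<close> the equation factors into two first-order ones, so it has a positive Green
  operator, and a Krein-Rutman argument gives a positive eigenfunction; the principal eigenvalue is
  then bounded by comparing this eigenfunction with sub- and supersolutions at a touching point.
  The lower bound uses a Gaussian times a bump at scale \<open>\<surd>\<epsilon>\<close> around each zero. The upper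
  bound uses the periodic supersolution \<open>exp(- Q / \<epsilon>)\<close> with \<open>Q' = \<theta> b / a\<close>, where
  \<open>0 \<le> \<theta> \<le> 1\<close>, \<open>\<theta> = 1\<close> exactly at the zeros with \<open>b' > 0\<close> and \<open>\<theta> = 0\<close> exactly at the other
  zeros. That \<open>b\<close> changes sign is what allows \<open>\<theta>\<close> to be chosen with \<open>\<integral> \<theta> b / a = 0\<close>, i.e. with
  \<open>Q\<close> periodic.
\<close>

subsection \<open>Periodic functions\<close>

text \<open>The value at a zero \<open>p\<close> comes from linearizing there. With
  \<open>\<beta> = b'(p)\<close>, the operator \<open>a(p) u'' + \<beta> y u'\<close> has the
  positive eigenfunctions \<open>1\<close>, with eigenvalue 0, and
  \<open>exp (- \<beta> y^2 / (2 a(p)))\<close>, with eigenvalue \<open>- \<beta>\<close>; the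
  latter decays only for \<open>\<beta> > 0\<close>. On the circle the operator is in general not
  symmetrizable, because an antiderivative of \<open>b / (\<epsilon> a)\<close> need not be
  periodic; comparison of positive functions therefore takes the place of a Rayleigh quotient. The
  upper bound meets the same obstacle: \<open>Q' = b / a\<close> gives the right value at the zeros
  with \<open>b' > 0\<close> and a constant \<open>Q\<close> at the others, but no single one of
  them serves both kinds. The factor \<open>\<theta>\<close> interpolates between them, and at a
  zero of \<open>b\<close> the derivative of \<open>\<theta> b\<close> is just
  \<open>\<theta> b'\<close>. Eigenvalues are complex and the principal one is singled out by its
  real part, so the positive eigenfunction also has to be shown to dominate every complex one. Both
  bounds apply to any positive eigenfunction, so convergence as \<epsilon> tends to 0 is a result of
  the proof.\<close>

lemma periodic_add_int:
  assumes "periodic f"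
  shows "f (t + of_int k) = f t"
proof (induction k rule: int_induct[where k=0])
  case (step1 i)
  then show ?case
    using assms unfolding periodic_def by (metis add.assoc of_int_1 of_int_add)
next
  case (step2 i)
  have "f (t + of_int (i - 1)) = f (t + of_int (i - 1) + 1)"
    using assms unfolding periodic_def by metis
  then show ?case using step2 by simp
qed simp

lemma periodic_frac: "periodic f \<Longrightarrow> f (frac t) = f t"
  using periodic_add_int[of f t "- \<lfloor>t\<rfloor>"] by (simp add: frac_def)

lemma periodicD: "periodic f \<Longrightarrow> f (t + 1) = f t"
  by (simp add: periodic_def)

lemma Ck_circle_0_iff: "f \<in> Ck_circle 0 \<longleftrightarrow> periodic f \<and> continuous_on UNIV f"
  by (simp add: Ck_circle_def Ck_on_def nderiv_def)

lemma Ck_circle_0_const [simp]: "(\<lambda>t. k) \<in> Ck_circle 0"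
  by (simp add: Ck_circle_0_iff periodic_def)

lemma Ck_circle_0_arith:
  fixes f g :: "real \<Rightarrow> real"
  assumes "f \<in> Ck_circle 0" "g \<in> Ck_circle 0"
  shows "(\<lambda>t. f t + g t) \<in> Ck_circle 0" "(\<lambda>t. f t - g t) \<in> Ck_circle 0"
    "(\<lambda>t. f t * g t) \<in> Ck_circle 0" "(\<lambda>t. max (f t) (g t)) \<in> Ck_circle 0"
    "(\<And>t. g t \<noteq> 0) \<Longrightarrow> (\<lambda>t. f t / g t) \<in> Ck_circle 0"
  using assms by (auto simp: Ck_circle_0_iff periodic_def intro!: continuous_intros)

lemma Ck_circle_0_reflect:
  fixes f :: "real \<Rightarrow> real"
  assumes "f \<in> Ck_circle 0"
  shows "(\<lambda>t. f (- t)) \<in> Ck_circle 0"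
proof -
  have "f (- t - 1) = f (- t)" for t
    using assms periodicD[of f "- t - 1"] by (simp add: Ck_circle_0_iff)
  then show ?thesis
    using assms unfolding Ck_circle_0_iff periodic_def
    by (auto intro!: continuous_on_compose2[of UNIV f UNIV uminus] continuous_intros)
qed

lemma Ck_circle_0_attains_sup:
  fixes f :: "real \<Rightarrow> real"
  assumes "f \<in> Ck_circle 0"
  obtains s where "\<And>t. f t \<le> f s"
proof -
  have "continuous_on {0..1} f"
    using assms continuous_on_subset by (auto simp: Ck_circle_0_iff)
  then obtain s where s: "\<And>t. t \<in> {0..1} \<Longrightarrow> f t \<le> f s"
    using continuous_attains_sup[of "{0..1::real}" f] by fastforce
  have "f t \<le> f s" for t
    using s[of "frac t"] periodic_frac[of f t] assms frac_lt_1[of t]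
    by (simp add: Ck_circle_0_iff less_imp_le)
  then show ?thesis using that by blast
qed

lemma Ck_circle_0_attains_inf:
  fixes f :: "real \<Rightarrow> real"
  assumes "f \<in> Ck_circle 0"
  obtains s where "\<And>t. f s \<le> f t"
  using Ck_circle_0_attains_sup[OF Ck_circle_0_arith(2)[OF Ck_circle_0_const[of 0] assms]]
  by (metis diff_0 neg_le_iff_le)

lemma Ck_circle_0_bounded:
  fixes f :: "real \<Rightarrow> real"
  assumes "f \<in> Ck_circle 0"
  obtains m where "m > 0" "\<And>t. \<bar>f t\<bar> \<le> m"
proof -
  obtain s1 s2 where "\<And>t. f t \<le> f s1" "\<And>t. f s2 \<le> f t"
    using Ck_circle_0_attains_sup[OF assms] Ck_circle_0_attains_inf[OF assms] by metis
  then have "\<bar>f t\<bar> \<le> max 1 (max (f s1) (- f s2))" for t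
    by (smt (verit))
  then show ?thesis using that[of "max 1 (max (f s1) (- f s2))"] by auto
qed

lemma Ck_circle_0_pos_lower:
  fixes f :: "real \<Rightarrow> real"
  assumes "f \<in> Ck_circle 0" "\<And>t. f t > 0"
  obtains m where "m > 0" "\<And>t. m \<le> f t"
  using Ck_circle_0_attains_inf[OF assms(1)] assms(2) by metis

lemma periodic_DERIV:
  fixes f :: "real \<Rightarrow> real"
  assumes "periodic f" "\<And>t. (f has_real_derivative f' t) (at t)"
  shows "periodic f'"
  unfolding periodic_def
proof
  fix t
  have "((\<lambda>s. f (s + 1)) has_real_derivative f' (t + 1)) (at t)"
    using DERIV_shift[of f "f' (t+1)" t 1] assms(2) by simp
  then show "f' (t + 1) = f' t"
    using assms by (auto simp: periodic_def intro: DERIV_unique)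
qed

lemma DERIV_imp_continuous_on: "(\<And>t. (f has_real_derivative f' t) (at t)) \<Longrightarrow> continuous_on S f"
  by (meson DERIV_isCont continuous_at_imp_continuous_on)

lemma antiderivative_exists:
  fixes f :: "real \<Rightarrow> real"
  assumes "continuous_on UNIV f"
  obtains F where "\<And>t. (F has_real_derivative f t) (at t)"
  using einterval_antiderivative[of "-\<infinity>" "\<infinity>" f] assms
  by (auto simp: continuous_on_eq_continuous_at has_real_derivative_iff_has_vector_derivative)

subsection \<open>Periodic solutions of first-order equations\<close>

text \<open>The circle has no boundary, so a minimum point is always critical: there
  \<open>f = \<beta> g\<close>, which fixes the sign of the minimum of \<open>g\<close>.\<close>

lemma decay_eq_maximum_principle:
  fixes \<beta> f g :: "real \<Rightarrow> real"
  assumes "\<And>t. \<beta> t > 0" "periodic g" "\<And>t. (g has_real_derivative f t - \<beta> t * g t) (at t)"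
    and "\<And>t. f t \<ge> 0"
  shows "g t \<ge> 0"
proof -
  have "g \<in> Ck_circle 0"
    using assms(2) DERIV_imp_continuous_on[OF assms(3)] by (simp add: Ck_circle_0_iff)
  then obtain s where s: "\<And>t. g s \<le> g t" using Ck_circle_0_attains_inf by blast
  have "f s - \<beta> s * g s = 0"
    using DERIV_local_min[OF assms(3)[of s], of 1] s by auto
  then have "g s \<ge> 0" using assms(1,4)[of s]
    by (smt (verit) zero_le_mult_iff)
  then show ?thesis using s[of t] by simp
qed

text \<open>Variation of constants with the integrating factor \<open>E\<close>. A periodic member
  of the family of solutions exists because \<open>\<beta> > 0\<close> makes the multiplier
  \<open>exp d\<close> of \<open>E\<close> over one period differ from 1.\<close>

lemma decay_eq_solvable:
  fixes \<beta> f :: "real \<Rightarrow> real"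
  assumes "\<beta> \<in> Ck_circle 0" "\<And>t. \<beta> t > 0" "f \<in> Ck_circle 0"
  obtains g where "periodic g" "\<And>t. (g has_real_derivative f t - \<beta> t * g t) (at t)"
proof -
  obtain F where F: "\<And>t. (F has_real_derivative \<beta> t) (at t)"
    using antiderivative_exists[of \<beta>] assms by (auto simp: Ck_circle_0_iff)
  define E where "E t = exp (F t)" for t
  have E: "(E has_real_derivative E t * \<beta> t) (at t)" for t
    unfolding E_def by (auto intro!: derivative_eq_intros F)
  have "continuous_on UNIV (\<lambda>t. E t * f t)"
    using assms DERIV_imp_continuous_on[OF E] by (auto simp: Ck_circle_0_iff intro!: continuous_intros)
  then obtain H where H: "\<And>t. (H has_real_derivative E t * f t) (at t)"
    using antiderivative_exists by blast
  define d where "d = F 1 - F 0"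
  have per: "\<beta> (t+1) = \<beta> t" "f (t+1) = f t" for t
    using assms by (auto simp: Ck_circle_0_iff periodic_def)
  have d: "F (t + 1) - F t = d" for t
  proof -
    have "((\<lambda>t. F (t+1) - F t) has_real_derivative 0) (at t)" for t
      using F[of "t+1"] F[of t] per by (auto intro!: derivative_eq_intros simp: DERIV_shift)
    then show ?thesis using DERIV_isconst_all[of "\<lambda>t. F (t+1) - F t" t 0] by (simp add: d_def)
  qed
  have "F 0 < F 1"
    by (rule DERIV_pos_imp_increasing) (use F assms(2) in auto)
  then have d0: "exp d > 1" by (simp add: d_def)
  have E1: "E (t+1) = exp d * E t" for t
    using d[of t] by (simp add: E_def flip: exp_add) 
  define C where "C = H 1 - exp d * H 0"
  have C: "H (t + 1) - exp d * H t = C" for t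
  proof -
    have "((\<lambda>t. H (t+1) - exp d * H t) has_real_derivative 0) (at t)" for t
      using H[of "t+1"] H[of t] per E1[of t] by (auto intro!: derivative_eq_intros simp: DERIV_shift)
    then show ?thesis
      using DERIV_isconst_all[of "\<lambda>t. H (t+1) - exp d * H t" t 0] by (simp add: C_def)
  qed
  \<comment> \<open>The constant for which \<open>K + H\<close> is multiplied by
    \<open>exp d\<close> over one period, exactly as \<open>E\<close> is, so that their quotient is
    periodic.\<close>
  define K where "K = C / (exp d - 1)"
  have K: "K + C = exp d * K" using d0 by (simp add: K_def field_simps)
  define g where "g t = (K + H t) / E t" for t
  have E0: "E t > 0" for t by (simp add: E_def)
  have "periodic g"
    unfolding periodic_def
  proof
    fix t
    have "K + H (t+1) = exp d * (K + H t)" using C[of t] K by (simp add: algebra_simps)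
    then show "g (t+1) = g t" using E1[of t] by (simp add: g_def)
  qed
  moreover have "(g has_real_derivative f t - \<beta> t * g t) (at t)" for t
    unfolding g_def using E0[of t]
    by (auto intro!: derivative_eq_intros H E simp: field_simps)
  ultimately show ?thesis using that by blast
qed

text \<open>A choice instead of the explicit formula: existence and uniqueness characterize the
  solution, and linearity then follows from uniqueness.\<close>

definition decay_sol :: "(real \<Rightarrow> real) \<Rightarrow> (real \<Rightarrow> real) \<Rightarrow> real \<Rightarrow> real" where
  "decay_sol \<beta> f = (SOME g. periodic g \<and> (\<forall>t. (g has_real_derivative f t - \<beta> t * g t) (at t)))"

context
  fixes \<beta> :: "real \<Rightarrow> real"
  assumes \<beta>: "\<beta> \<in> Ck_circle 0" "\<And>t. \<beta> t > 0"
begin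

lemma decay_sol:
  assumes "f \<in> Ck_circle 0"
  shows "periodic (decay_sol \<beta> f)"
    "(decay_sol \<beta> f has_real_derivative f t - \<beta> t * decay_sol \<beta> f t) (at t)"
proof -
  have "\<exists>g. periodic g \<and> (\<forall>t. (g has_real_derivative f t - \<beta> t * g t) (at t))"
    using decay_eq_solvable[OF \<beta> assms] by metis
  from someI_ex[OF this, folded decay_sol_def]
  show "periodic (decay_sol \<beta> f)"
    "(decay_sol \<beta> f has_real_derivative f t - \<beta> t * decay_sol \<beta> f t) (at t)"
    by auto
qed

lemma decay_sol_Ck_circle: "f \<in> Ck_circle 0 \<Longrightarrow> decay_sol \<beta> f \<in> Ck_circle 0"
  using decay_sol(1) DERIV_imp_continuous_on[OF decay_sol(2)] by (simp add: Ck_circle_0_iff)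

lemma decay_sol_unique:
  assumes "f \<in> Ck_circle 0" "periodic g" "\<And>t. (g has_real_derivative f t - \<beta> t * g t) (at t)"
  shows "decay_sol \<beta> f = g"
proof -
  have le: "g1 t \<le> g2 t"
    if "periodic g1" "\<And>t. (g1 has_real_derivative f t - \<beta> t * g1 t) (at t)"
      "periodic g2" "\<And>t. (g2 has_real_derivative f t - \<beta> t * g2 t) (at t)" for g1 g2 t
  proof -
    have "periodic (\<lambda>t. g2 t - g1 t)"
      using that by (simp add: periodic_def)
    moreover have "((\<lambda>t. g2 t - g1 t) has_real_derivative 0 - \<beta> t * (g2 t - g1 t)) (at t)" for t
      by (rule derivative_eq_intros that refl)+ (simp add: algebra_simps)
    ultimately have "0 \<le> g2 t - g1 t"
      by (rule decay_eq_maximum_principle[OF \<beta>(2), where f="\<lambda>_. 0"]) simp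
    then show ?thesis by simp
  qed
  show ?thesis
    by (intro ext antisym le decay_sol assms)
qed

lemma decay_sol_lincomb:
  assumes "f \<in> Ck_circle 0" "g \<in> Ck_circle 0"
  shows "decay_sol \<beta> (\<lambda>t. f t + k * g t) = (\<lambda>t. decay_sol \<beta> f t + k * decay_sol \<beta> g t)"
proof (rule decay_sol_unique)
  show "(\<lambda>t. f t + k * g t) \<in> Ck_circle 0"
    by (intro Ck_circle_0_arith assms Ck_circle_0_const)
  show "periodic (\<lambda>t. decay_sol \<beta> f t + k * decay_sol \<beta> g t)"
    using decay_sol(1)[OF assms(1)] decay_sol(1)[OF assms(2)] by (simp add: periodic_def)
  show "((\<lambda>t. decay_sol \<beta> f t + k * decay_sol \<beta> g t) has_real_derivative
      (f t + k * g t) - \<beta> t * (decay_sol \<beta> f t + k * decay_sol \<beta> g t)) (at t)" for t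
    by (auto intro!: derivative_eq_intros decay_sol(2) assms simp: algebra_simps)
qed

lemma decay_sol_nonneg:
  assumes "f \<in> Ck_circle 0" "\<And>t. f t \<ge> 0"
  shows "decay_sol \<beta> f t \<ge> 0"
  using decay_eq_maximum_principle[OF \<beta>(2) decay_sol[OF assms(1)] assms(2)] .

text \<open>Multiplied by the integrating factor, the solution is nondecreasing. A zero at
  \<open>t\<close> would make it vanish on the whole half-line left of \<open>t\<close>, and with it
  the source, although the source is nonzero at translates of \<open>s\<close> lying there.\<close>

lemma decay_sol_pos:
  assumes f: "f \<in> Ck_circle 0" "\<And>t. f t \<ge> 0" and s: "f s \<noteq> 0"
  shows "decay_sol \<beta> f t > 0"
proof (rule ccontr)
  assume "\<not> decay_sol \<beta> f t > 0"
  then have t0: "decay_sol \<beta> f t = 0" using decay_sol_nonneg[OF f, of t] by simp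
  obtain F where F: "\<And>t. (F has_real_derivative \<beta> t) (at t)"
    using antiderivative_exists[of \<beta>] \<beta> by (auto simp: Ck_circle_0_iff)
  define h where "h t = exp (F t) * decay_sol \<beta> f t" for t
  have h: "(h has_real_derivative exp (F t) * f t) (at t)" for t
    unfolding h_def by (auto intro!: derivative_eq_intros F decay_sol f simp: algebra_simps)
  have mono: "h x \<le> h y" if "x \<le> y" for x y
    using DERIV_nonneg_imp_nondecreasing[OF that, of h] h f(2) by (meson exp_ge_zero mult_nonneg_nonneg)
  \<comment> \<open>The extra \<open>- 1\<close> puts the translate \<open>r\<close> strictly left
    of \<open>t\<close>, inside the open half-line where \<open>h\<close> vanishes.\<close>
  define k where "k = \<lfloor>t - s\<rfloor> - 1"
  define r where "r = s + of_int k"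
  have r: "r < t" unfolding r_def k_def by linarith
  have h0: "h x = 0" if "x \<le> t" for x
    using mono[OF that] t0 decay_sol_nonneg[OF f, of x]
    by (simp add: h_def mult_le_0_iff)
  have "(h has_real_derivative 0) (at r)"
    by (rule has_field_derivative_transform_within_open[of "\<lambda>_. 0" _ _ "{..<t}"]) (use r h0 in auto)
  then have "exp (F r) * f r = 0"
    using h DERIV_unique by blast
  then show False
    using s f periodic_add_int[of f s k] by (simp add: r_def Ck_circle_0_iff)
qed

end

subsection \<open>A positive Green operator\<close>

(* The equation u'' + (beta - kappa) u' - kappa beta u = - f factors into
   u' = kappa u - g and g' = f - beta g; reflecting the circle turns the first of these
   into a decaying equation as well. *)
definition green :: "real \<Rightarrow> (real \<Rightarrow> real) \<Rightarrow> (real \<Rightarrow> real) \<Rightarrow> real \<Rightarrow> real" where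
  "green \<kappa> \<beta> f = (\<lambda>t. decay_sol (\<lambda>_. \<kappa>) (\<lambda>s. decay_sol \<beta> f (- s)) (- t))"

context
  fixes \<beta> :: "real \<Rightarrow> real" and \<kappa> :: real
  assumes \<beta>: "\<beta> \<in> Ck_circle 0" "\<And>t. \<beta> t > 0" and \<kappa>: "\<kappa> > 0"
begin

lemma green_Ck_circle: "f \<in> Ck_circle 0 \<Longrightarrow> green \<kappa> \<beta> f \<in> Ck_circle 0"
  unfolding green_def
  by (rule Ck_circle_0_reflect decay_sol_Ck_circle[OF Ck_circle_0_const \<kappa>]
      decay_sol_Ck_circle[OF \<beta>] | assumption)+

lemma green_DERIV:
  assumes "f \<in> Ck_circle 0"
  shows "(green \<kappa> \<beta> f has_real_derivative \<kappa> * green \<kappa> \<beta> f t - decay_sol \<beta> f t) (at t)"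
proof -
  have "(\<lambda>s. decay_sol \<beta> f (- s)) \<in> Ck_circle 0"
    by (rule Ck_circle_0_reflect decay_sol_Ck_circle[OF \<beta>] assms)+
  from decay_sol(2)[OF Ck_circle_0_const \<kappa> this, of "- t"]
  have "((\<lambda>t. decay_sol (\<lambda>_. \<kappa>) (\<lambda>s. decay_sol \<beta> f (- s)) (- t)) has_real_derivative
      (decay_sol \<beta> f t - \<kappa> * decay_sol (\<lambda>_. \<kappa>) (\<lambda>s. decay_sol \<beta> f (- s)) (- t)) * (- 1)) (at t)"
    by (intro DERIV_chain2[where g = uminus] DERIV_minus DERIV_ident) simp
  then show ?thesis
    by (simp add: green_def)
qed

lemma green_lincomb:
  assumes "f \<in> Ck_circle 0" "g \<in> Ck_circle 0"
  shows "green \<kappa> \<beta> (\<lambda>t. f t + k * g t) t = green \<kappa> \<beta> f t + k * green \<kappa> \<beta> g t"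
proof -
  have "(\<lambda>s. decay_sol \<beta> f (- s)) \<in> Ck_circle 0" "(\<lambda>s. decay_sol \<beta> g (- s)) \<in> Ck_circle 0"
    by (rule Ck_circle_0_reflect decay_sol_Ck_circle[OF \<beta>] assms)+
  then show ?thesis
    unfolding green_def decay_sol_lincomb[OF \<beta> assms]
    using decay_sol_lincomb[OF Ck_circle_0_const \<kappa>] by simp
qed

lemma green_nonneg:
  assumes "f \<in> Ck_circle 0" "\<And>t. f t \<ge> 0"
  shows "green \<kappa> \<beta> f t \<ge> 0"
proof -
  have "(\<lambda>s. decay_sol \<beta> f (- s)) \<in> Ck_circle 0"
    by (rule Ck_circle_0_reflect decay_sol_Ck_circle[OF \<beta>] assms)+
  then show ?thesis
    unfolding green_def
    by (rule decay_sol_nonneg[OF Ck_circle_0_const \<kappa>]) (rule decay_sol_nonneg[OF \<beta> assms])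
qed

lemma green_pos:
  assumes "f \<in> Ck_circle 0" "\<And>t. f t \<ge> 0" "f s \<noteq> 0"
  shows "green \<kappa> \<beta> f t > 0"
proof -
  \<comment> \<open>The form \<open>- 0\<close> is the reflected source of the second factor
    evaluated at 0, which provides the point of nonvanishing for that factor.\<close>
  have "decay_sol \<beta> f (- 0) > 0" by (rule decay_sol_pos[OF \<beta> assms])
  then have "decay_sol \<beta> f (- 0) \<noteq> 0" by simp
  moreover have "(\<lambda>s. decay_sol \<beta> f (- s)) \<in> Ck_circle 0"
    by (rule Ck_circle_0_reflect decay_sol_Ck_circle[OF \<beta>] assms)+
  ultimately show ?thesis
    unfolding green_def using decay_sol_pos[OF Ck_circle_0_const \<kappa>] decay_sol_nonneg[OF \<beta> assms(1,2)]
    by meson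
qed

lemma green_mono:
  assumes "f \<in> Ck_circle 0" "g \<in> Ck_circle 0" "\<And>t. f t \<le> g t"
  shows "green \<kappa> \<beta> f t \<le> green \<kappa> \<beta> g t"
proof -
  have "(\<lambda>t. g t - f t) \<in> Ck_circle 0" by (intro Ck_circle_0_arith assms)
  then have "0 \<le> green \<kappa> \<beta> (\<lambda>t. g t + (- 1) * f t) t"
    using green_nonneg assms(3) by simp
  then show ?thesis by (subst (asm) green_lincomb) (use assms in auto)
qed

lemma decay_sol_const: "decay_sol \<beta> (\<lambda>t. \<kappa> * \<beta> t) = (\<lambda>_. \<kappa>)"
  by (rule decay_sol_unique[OF \<beta>])
    (auto intro!: Ck_circle_0_arith \<beta> simp: periodic_def mult.commute)

text \<open>The normalization behind all later sup bounds: the second-order operator sends the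
  constant 1 to \<open>- \<kappa> \<beta>\<close>, so a source bounded by a multiple of
  \<open>\<kappa> \<beta>\<close> has its image bounded by that multiple.\<close>

lemma green_const: "green \<kappa> \<beta> (\<lambda>t. \<kappa> * \<beta> t) t = 1"
proof -
  have "decay_sol (\<lambda>_. \<kappa>) (\<lambda>_. \<kappa>) = (\<lambda>_. 1)"
    by (rule decay_sol_unique) (auto simp: \<kappa> periodic_def)
  then show ?thesis
    by (simp add: green_def decay_sol_const)
qed

lemma kb_Ck_circle: "(\<lambda>t. \<kappa> * \<beta> t) \<in> Ck_circle 0"
  by (intro Ck_circle_0_arith Ck_circle_0_const \<beta>)

lemma green_scale_const: "green \<kappa> \<beta> (\<lambda>t. m * (\<kappa> * \<beta> t)) t = m"
proof -
  have "green \<kappa> \<beta> (\<lambda>t. \<kappa> * \<beta> t + (m - 1) * (\<kappa> * \<beta> t)) t = m"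
    by (subst green_lincomb) (auto intro: kb_Ck_circle simp: green_const)
  then show ?thesis by (simp add: algebra_simps)
qed

lemma green_bounded:
  assumes f: "f \<in> Ck_circle 0" and "\<And>t. f t \<le> m * (\<kappa> * \<beta> t)"
  shows "green \<kappa> \<beta> f t \<le> m"
  using green_mono[OF f _ assms(2), of t] green_scale_const[of m t]
    Ck_circle_0_arith(3)[OF Ck_circle_0_const kb_Ck_circle] by simp

lemma green_diff_bounded:
  assumes f: "f \<in> Ck_circle 0" and g: "g \<in> Ck_circle 0" and "\<And>t. f t - g t \<le> m * (\<kappa> * \<beta> t)"
  shows "green \<kappa> \<beta> f t - green \<kappa> \<beta> g t \<le> m"
proof -
  have "green \<kappa> \<beta> (\<lambda>t. f t + (- 1) * g t) t \<le> m"
    by (rule green_bounded) (use assms in \<open>auto intro: Ck_circle_0_arith\<close>)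
  then show ?thesis by (subst (asm) green_lincomb[OF f g]) simp
qed

text \<open>The derivative is the difference of \<open>\<kappa> * green \<kappa> \<beta> f\<close>
  and \<open>decay_sol \<beta> f\<close>, and both lie between 0 and \<open>\<kappa> * m\<close> by
  comparison with the source \<open>m * (\<kappa> * \<beta> t)\<close>.\<close>

lemma green_Lipschitz:
  assumes f: "f \<in> Ck_circle 0" "\<And>t. 0 \<le> f t" "\<And>t. f t \<le> m * (\<kappa> * \<beta> t)"
  shows "\<bar>green \<kappa> \<beta> f s - green \<kappa> \<beta> f t\<bar> \<le> \<kappa> * m * \<bar>s - t\<bar>"
proof -
  have *: "\<bar>\<kappa> * green \<kappa> \<beta> f t - decay_sol \<beta> f t\<bar> \<le> \<kappa> * m" for t
  proof -
    have "0 \<le> decay_sol \<beta> (\<lambda>t. m * (\<kappa> * \<beta> t) + (- 1) * f t) t"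
      using f(1,3) Ck_circle_0_arith(3)[OF Ck_circle_0_const kb_Ck_circle]
      by (intro decay_sol_nonneg[OF \<beta>]) (auto intro: Ck_circle_0_arith)
    also have "\<dots> = decay_sol \<beta> (\<lambda>t. m * (\<kappa> * \<beta> t)) t - decay_sol \<beta> f t"
      by (subst decay_sol_lincomb[OF \<beta>])
        (auto simp: f intro!: Ck_circle_0_arith(3)[OF Ck_circle_0_const kb_Ck_circle])
    also have "decay_sol \<beta> (\<lambda>t. m * (\<kappa> * \<beta> t)) = (\<lambda>t. m * \<kappa>)"
      by (rule decay_sol_unique[OF \<beta>])
        (auto intro!: Ck_circle_0_arith(3)[OF Ck_circle_0_const kb_Ck_circle] simp: periodic_def)
    finally have "decay_sol \<beta> f t \<le> \<kappa> * m" by (simp add: mult.commute)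
    moreover have "0 \<le> decay_sol \<beta> f t" by (rule decay_sol_nonneg[OF \<beta> f(1,2)])
    moreover have "0 \<le> \<kappa> * green \<kappa> \<beta> f t" "\<kappa> * green \<kappa> \<beta> f t \<le> \<kappa> * m"
      using green_nonneg[OF f(1,2)] green_bounded[OF f(1,3)] \<kappa> by auto
    ultimately show ?thesis by linarith
  qed
  have "norm (green \<kappa> \<beta> f s - green \<kappa> \<beta> f t) \<le> \<kappa> * m * norm (s - t)"
  proof (rule field_differentiable_bound[where S = UNIV])
    show "(green \<kappa> \<beta> f has_field_derivative \<kappa> * green \<kappa> \<beta> f z - decay_sol \<beta> f z)
        (at z within UNIV)" for z
      using green_DERIV[OF f(1)] by simp
    show "norm (\<kappa> * green \<kappa> \<beta> f z - decay_sol \<beta> f z) \<le> \<kappa> * m" for z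
      using * by simp
  qed auto
  then show ?thesis by simp
qed

text \<open>The Lipschitz bound depends on the sources only through \<open>m\<close>, so
  Arzela-Ascoli applies on one period.\<close>

lemma green_compact:
  assumes f: "\<And>n. f n \<in> Ck_circle 0" "\<And>n t. 0 \<le> f n t" "\<And>n t. f n t \<le> m * (\<kappa> * \<beta> t)"
  obtains g k where "g \<in> Ck_circle 0" "strict_mono (k :: nat \<Rightarrow> nat)"
    "\<And>e. 0 < e \<Longrightarrow> \<forall>\<^sub>F n in sequentially. \<forall>t. \<bar>green \<kappa> \<beta> (f (k n)) t - g t\<bar> < e"
proof -
  define G where "G n = green \<kappa> \<beta> (f n)" for n
  have G: "G n \<in> Ck_circle 0" for n unfolding G_def by (intro green_Ck_circle f)
  have b: "0 \<le> G n t" "G n t \<le> m" for n t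
    using green_nonneg[OF f(1,2)] green_bounded[OF f(1,3)] by (auto simp: G_def)
  have m: "0 \<le> m" using b[of 0 0] by linarith
  have lip: "\<bar>G n s - G n t\<bar> \<le> \<kappa> * m * \<bar>s - t\<bar>" for n s t
    unfolding G_def by (rule green_Lipschitz[OF f])
  obtain g0 :: "real \<Rightarrow> real" and k where g0: "continuous_on {0..1} g0" "strict_mono (k :: nat \<Rightarrow> nat)"
    "\<And>e. 0 < e \<Longrightarrow> \<exists>N. \<forall>n x. n \<ge> N \<and> x \<in> {0..1} \<longrightarrow> norm (G (k n) x - g0 x) < e"
  proof (rule Arzela_Ascoli[of "{0..1::real}" G m])
    show "norm (G n x) \<le> m" for n x using b[of n x] by simp
    fix x e :: real assume e: "0 < e"
    show "\<exists>d>0. \<forall>n y. y \<in> {0..1} \<and> norm (x - y) < d \<longrightarrow> norm (G n x - G n y) < e"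
    \<comment> \<open>Only \<open>0 \<le> m\<close> is known; the summand 1 keeps the denominator
      positive.\<close>
    proof (intro exI[of _ "e / (\<kappa> * m + 1)"] conjI allI impI)
      have p: "\<kappa> * m + 1 > 0" using m \<kappa> by (simp add: add_nonneg_pos)
      then show "0 < e / (\<kappa> * m + 1)" using e by simp
      fix n y assume "y \<in> {0..1} \<and> norm (x - y) < e / (\<kappa> * m + 1)"
      then have "(\<kappa> * m + 1) * \<bar>x - y\<bar> < e" using p by (simp add: field_simps)
      then show "norm (G n x - G n y) < e"
        using lip[of n x y] by (simp add: algebra_simps)
    qed
  qed auto
  \<comment> \<open>Continuity at the integers is not visible from this formula; it follows from
    uniform convergence on the whole line.\<close>
  define g where "g t = g0 (frac t)" for t
  have u: "\<forall>\<^sub>F n in sequentially. \<forall>t. \<bar>G (k n) t - g t\<bar> < e" if e: "0 < e" for e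
  proof -
    obtain N where N: "\<And>n x. n \<ge> N \<Longrightarrow> x \<in> {0..1} \<Longrightarrow> norm (G (k n) x - g0 x) < e"
      using g0(3)[OF e] by blast
    have "\<bar>G (k n) t - g t\<bar> < e" if "n \<ge> N" for n t
      using N[OF that, of "frac t"] periodic_frac[of "G (k n)" t] G[of "k n"] frac_lt_1[of t]
      by (simp add: g_def Ck_circle_0_iff less_imp_le)
    then show ?thesis by (auto simp: eventually_sequentially)
  qed
  have "uniform_limit UNIV (\<lambda>n. G (k n)) g sequentially"
    unfolding uniform_limit_iff using u by (simp add: dist_real_def)
  then have "continuous_on UNIV g"
    by (rule uniform_limit_theorem[rotated]) (use G in \<open>auto simp: Ck_circle_0_iff\<close>)
  moreover have "periodic g" by (simp add: periodic_def g_def frac_def)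
  ultimately show ?thesis
    using that[of g k] g0(2) u by (simp add: Ck_circle_0_iff G_def)
qed

end

subsection \<open>Existence of a positive eigenfunction\<close>

(* Krein-Rutman in the manner of Collatz and Wielandt: the eigenvalue is the largest l that
   admits a nonnegative f with f <= T (V_l f), where T is the Green operator. *)
lemma green_fixed_point:
  fixes \<beta> c \<rho> :: "real \<Rightarrow> real" and \<kappa> L :: real
  assumes \<beta>: "\<beta> \<in> Ck_circle 0" "\<And>t. \<beta> t > 0" and \<kappa>: "\<kappa> > 0"
    and c: "c \<in> Ck_circle 0" and \<rho>: "\<rho> \<in> Ck_circle 0" "\<And>t. \<rho> t > 0"
    and L: "\<And>t. c t \<le> L" and pos: "\<And>t. \<kappa> * \<beta> t + (c t - (L + 1)) * \<rho> t > 0"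
  obtains l g where "g \<in> Ck_circle 0" "\<And>t. g t > 0"
    "g = green \<kappa> \<beta> (\<lambda>t. (\<kappa> * \<beta> t + (c t - l) * \<rho> t) * g t)"
proof -
  define T where "T = green \<kappa> \<beta>"
  \<comment> \<open>A fixed point \<open>u = T (V l u)\<close> solves
    \<open>u'' + (\<beta> - \<kappa>) u' + (c - l) \<rho> u = 0\<close>: the summand
    \<open>\<kappa> \<beta>\<close> cancels the zeroth-order term built into
    \<open>T\<close>.\<close>
  define V where "V l t = \<kappa> * \<beta> t + (c t - l) * \<rho> t" for l t
  note T_lin = green_lincomb[OF \<beta> \<kappa>, folded T_def]
    and T_mono = green_mono[OF \<beta> \<kappa>, folded T_def]
    and T_pos = green_pos[OF \<beta> \<kappa>, folded T_def]
    and T_nonneg = green_nonneg[OF \<beta> \<kappa>, folded T_def]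
    and T_Ck = green_Ck_circle[OF \<beta> \<kappa>, folded T_def]
    and T_const = green_const[OF \<beta> \<kappa>, folded T_def]
    and T_diff = green_diff_bounded[OF \<beta> \<kappa>, folded T_def]
    and T_bounded = green_bounded[OF \<beta> \<kappa>, folded T_def]
  note kb = kb_Ck_circle[OF \<beta> \<kappa>]
  have V: "V l \<in> Ck_circle 0" for l
    unfolding V_def by (intro Ck_circle_0_arith kb c \<rho> Ck_circle_0_const)
  have VM: "(\<lambda>t. V l t * f t) \<in> Ck_circle 0" if "f \<in> Ck_circle 0" for l f
    by (intro Ck_circle_0_arith V that)
  have V_mono: "V l' t \<le> V l t" if "l \<le> l'" for l l' t
    using that \<rho>(2)[of t] by (simp add: V_def mult_right_mono)
  have V_pos: "V l t > 0" if "l \<le> L + 1" for l t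
    using V_mono[OF that, of t] pos[of t] by (simp add: V_def)
  obtain d where d: "d > 0" "\<And>t. d \<le> \<kappa> * \<beta> t"
    using Ck_circle_0_pos_lower[OF kb] \<beta> \<kappa> by (metis mult_pos_pos)
  obtain c1 where c1: "\<And>t. c c1 \<le> c t" using Ck_circle_0_attains_inf[OF c] by metis
  define c0 where "c0 = c c1"
  have c0: "c0 \<le> c t" for t using c1 by (simp add: c0_def)
  \<comment> \<open>The cap \<open>L + 1\<close> keeps \<open>V l\<close> positive, hence
    \<open>f \<mapsto> T (V l f)\<close> monotone. Admissible values turn out to be at most
    \<open>L\<close>, so a gap of 1 remains for the perturbation that proves maximality. The
    normalization \<open>f t = 1\<close> prevents limits from being zero.\<close>
  define good where "good l f \<longleftrightarrow> l \<le> L + 1 \<and> f \<in> Ck_circle 0 \<and> (\<forall>t. 0 \<le> f t \<and> f t \<le> 1) \<and>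
    (\<exists>t. f t = 1) \<and> (\<forall>t. f t \<le> T (\<lambda>s. V l s * f s) t)" for l f
  define S where "S = {l. \<exists>f. good l f}"
  have "good c0 (\<lambda>_. 1)"
    unfolding good_def
  proof (intro conjI allI)
    show "c0 \<le> L + 1" using c0[of 0] L[of 0] by linarith
    fix t
    have "T (\<lambda>t. \<kappa> * \<beta> t) t \<le> T (V c0) t"
      by (rule T_mono[OF kb V]) (use c0 \<rho> in \<open>auto simp: V_def less_imp_le\<close>)
    then show "1 \<le> T (\<lambda>s. V c0 s * 1) t" using T_const by simp
  qed auto
  then have c0S: "c0 \<in> S" by (auto simp: S_def)
  \<comment> \<open>Comparison with the constant 1: for \<open>l > L\<close> the source lies below
    \<open>\<kappa> \<beta> + (L - l) \<rho>\<close>, whose image is everywhere less than 1.\<close>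
  have S_le: "l \<le> L" if "l \<in> S" for l
  proof (rule ccontr)
    assume l: "\<not> l \<le> L"
    obtain f where f: "good l f" using \<open>l \<in> S\<close> by (auto simp: S_def)
    then obtain s where s: "f s = 1" by (auto simp: good_def)
    have "f s \<le> T (\<lambda>t. V l t * f t) s" using f by (simp add: good_def)
    also have "\<dots> \<le> T (\<lambda>t. \<kappa> * \<beta> t + (L - l) * \<rho> t) s"
    proof (rule T_mono)
      show "(\<lambda>t. V l t * f t) \<in> Ck_circle 0" using f VM by (simp add: good_def)
      show "(\<lambda>t. \<kappa> * \<beta> t + (L - l) * \<rho> t) \<in> Ck_circle 0"
        by (intro Ck_circle_0_arith kb \<rho> Ck_circle_0_const)
      fix t
      have "V l t * f t \<le> V l t * 1"
        using V_pos[of l t] f by (intro mult_left_mono) (auto simp: good_def)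
      also have "\<dots> \<le> \<kappa> * \<beta> t + (L - l) * \<rho> t"
        using L[of t] \<rho>(2)[of t] by (simp add: V_def mult_right_mono)
      finally show "V l t * f t \<le> \<kappa> * \<beta> t + (L - l) * \<rho> t" .
    qed
    also have "\<dots> = 1 + (L - l) * T \<rho> s" by (simp add: T_lin[OF kb \<rho>(1)] T_const)
    also have "\<dots> < 1"
      using T_pos[OF \<rho>(1), of 0 s] \<rho>(2) l by (simp add: less_imp_le mult_less_0_iff)
        (metis less_irrefl)
    finally show False using s by simp
  qed
  have bdd: "bdd_above S" using S_le by (rule bdd_aboveI)
  define ls where "ls = Sup S"
  have ls_le: "ls \<le> L" unfolding ls_def using c0S S_le by (intro cSup_least) auto
  have "\<exists>l f. good l f \<and> ls - 1 / Suc n < l" for n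
  proof -
    have "ls - 1 / Suc n < Sup S" by (simp add: ls_def)
    then show ?thesis using less_cSup_iff[OF _ bdd] c0S by (auto simp: S_def)
  qed
  then obtain l f where good: "\<And>n. good (l n) (f n)" and l: "\<And>n. ls - 1 / Suc n < l n"
    by metis
  have l_le: "l n \<le> ls" for n
    unfolding ls_def by (rule cSup_upper[OF _ bdd]) (use good in \<open>auto simp: S_def\<close>)
  have fC: "f n \<in> Ck_circle 0" for n using good by (auto simp: good_def)
  have l1: "l n \<ge> ls - 1" for n
  proof -
    have "1 / real (Suc n) \<le> 1" by simp
    then show ?thesis using l[of n] by linarith
  qed
  have l_lim: "l \<longlonglongrightarrow> ls"
  proof (rule tendsto_sandwich[where f = "\<lambda>n. ls - 1 / Suc n" and h = "\<lambda>_. ls"])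
    show "(\<lambda>n. ls - 1 / Suc n) \<longlonglongrightarrow> ls"
      using tendsto_diff[OF tendsto_const LIMSEQ_inverse_real_of_nat, of ls]
      by (simp add: inverse_eq_divide)
  qed (use l l_le in \<open>auto simp: less_imp_le\<close>)
  obtain v where v: "v > 0" "\<And>t. \<bar>V (ls - 1) t\<bar> \<le> v" using Ck_circle_0_bounded[OF V] by blast
  have Vv: "V (l n) t \<le> v" "V ls t \<le> v" for n t
    using V_mono[OF l1[of n], of t] V_mono[of "ls - 1" ls t] v(2)[of t] by auto
  define m where "m = v / d"
  have m: "m > 0" using v d by (simp add: m_def)
  have Vf: "0 \<le> V (l n) t * f n t" "V (l n) t * f n t \<le> m * (\<kappa> * \<beta> t)" for n t
  proof -
    have p: "0 < V (l n) t" using V_pos[of "l n" t] l_le[of n] ls_le by simp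
    have f01: "0 \<le> f n t" "f n t \<le> 1" using good[of n] by (auto simp: good_def)
    show "0 \<le> V (l n) t * f n t" using p f01 by simp
    have "V (l n) t * f n t \<le> v * 1" using p f01 Vv(1)[of n t] v by (intro mult_mono) auto
    also have "v = m * d" using d by (simp add: m_def)
    also have "m * d * 1 \<le> m * (\<kappa> * \<beta> t)" using d m by simp
    finally show "V (l n) t * f n t \<le> m * (\<kappa> * \<beta> t)" .
  qed
  obtain g k where g: "g \<in> Ck_circle 0" and k: "strict_mono (k :: nat \<Rightarrow> nat)"
    and lim: "\<And>e. 0 < e \<Longrightarrow>
      \<forall>\<^sub>F n in sequentially. \<forall>t. \<bar>T (\<lambda>t. V (l (k n)) t * f (k n) t) t - g t\<bar> < e"
    using green_compact[OF \<beta> \<kappa>, where f = "\<lambda>n t. V (l n) t * f n t", OF VM[OF fC] Vf]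
    unfolding T_def by blast
  define G where "G n = T (\<lambda>t. V (l (k n)) t * f (k n) t)" for n
  have GC: "G n \<in> Ck_circle 0" for n unfolding G_def by (intro T_Ck VM fC)
  have G0: "0 \<le> G n t" "G n t \<le> m" for n t
    unfolding G_def using T_nonneg[OF VM[OF fC] Vf(1)] T_bounded[OF VM[OF fC] Vf(2)] by auto
  have fG: "f (k n) t \<le> G n t" for n t
    using good[of "k n"] by (simp add: good_def G_def)
  have g_lim: "(\<lambda>n. G n t) \<longlonglongrightarrow> g t" for t
    unfolding tendsto_iff dist_real_def G_def
    by (intro allI impI eventually_mono[OF lim]) auto
  have g0: "0 \<le> g t" for t using g_lim by (rule LIMSEQ_le_const) (use G0 in auto)
  obtain s where s: "\<And>t. g t \<le> g s" using Ck_circle_0_attains_sup[OF g] by metis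
  \<comment> \<open>Every \<open>f (k n)\<close> attains 1 and lies below \<open>G n\<close>, so the
    uniform limit of \<open>G n\<close> cannot be nonpositive.\<close>
  have gs: "g s > 0"
  proof (rule ccontr)
    assume "\<not> 0 < g s"
    then have "g t \<le> 0" for t using s[of t] by simp
    moreover obtain n where "\<And>t. \<bar>G n t - g t\<bar> < 1"
      using eventually_happens[OF lim[of 1]] unfolding G_def by auto
    moreover obtain t where "f (k n) t = 1" using good[of "k n"] by (auto simp: good_def)
    ultimately show False using fG[of n t] by (smt (verit))
  qed
  obtain r where r: "r > 0" "\<And>t. \<bar>\<rho> t\<bar> \<le> r" using Ck_circle_0_bounded[OF \<rho>(1)] by blast
  \<comment> \<open>The functions \<open>f (k n)\<close> need not converge. Their images
    \<open>G n\<close> do, and monotonicity turns \<open>f \<le> G\<close> into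
    \<open>G \<le> T (V G)\<close>, which survives the limit.\<close>
  have sup_sol: "g t \<le> T (\<lambda>s. V ls s * g s) t" for t
  proof (rule field_le_epsilon)
    fix e :: real assume e: "0 < e"
    \<comment> \<open>One half of \<open>e\<close> pays for replacing \<open>g\<close> by
      \<open>G n\<close> on the left. The other half pays for the change of source, which is at most
      \<open>e1 * (v + r * m)\<close>; the lower bound \<open>d\<close> of
      \<open>\<kappa> \<beta>\<close> converts this into a multiple of
      \<open>\<kappa> \<beta>\<close>.\<close>
    define e1 where "e1 = min (e / 2) (e / 2 * d / (v + r * m))"
    have vm: "v + r * m > 0" using v r m by (simp add: add_pos_pos)
    have e1: "e1 > 0" using e d vm by (simp add: e1_def)
    have "e1 \<le> e / 2 * d / (v + r * m)" by (simp add: e1_def)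
    then have e1': "e1 * (v + r * m) \<le> e / 2 * d" using vm by (simp only: pos_le_divide_eq)
    have "\<forall>\<^sub>F n in sequentially. \<bar>l (k n) - ls\<bar> < e1"
      using LIMSEQ_subseq_LIMSEQ[OF l_lim k] e1 by (auto simp: tendsto_iff dist_real_def)
    with lim[OF e1] have "\<forall>\<^sub>F n in sequentially. (\<forall>t. \<bar>G n t - g t\<bar> < e1) \<and> \<bar>l (k n) - ls\<bar> < e1"
      unfolding G_def by (rule eventually_conj)
    from eventually_happens'[OF sequentially_bot this]
    obtain n where n: "\<And>t. \<bar>G n t - g t\<bar> < e1" "\<bar>l (k n) - ls\<bar> < e1"
      by blast
    have "T (\<lambda>s. V (l (k n)) s * f (k n) s) t \<le> T (\<lambda>s. V (l (k n)) s * G n s) t"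
    proof (rule T_mono[OF VM[OF fC] VM[OF GC]])
      show "V (l (k n)) s * f (k n) s \<le> V (l (k n)) s * G n s" for s
        using fG[of n s] V_pos[of "l (k n)" s] l_le[of "k n"] ls_le
        by (intro mult_left_mono) auto
    qed
    then have "G n t \<le> T (\<lambda>s. V (l (k n)) s * G n s) t" by (simp add: G_def)
    moreover have "T (\<lambda>s. V (l (k n)) s * G n s) t - T (\<lambda>s. V ls s * g s) t \<le> e / 2"
    proof (rule T_diff[OF VM[OF GC] VM[OF g]])
      fix s
      have "V (l (k n)) s * G n s - V ls s * g s = V ls s * (G n s - g s) + (ls - l (k n)) * (\<rho> s * G n s)"
        by (simp add: V_def algebra_simps)
      also have "\<dots> \<le> v * e1 + e1 * (r * m)"
      proof (rule add_mono)
        have "V ls s * (G n s - g s) \<le> V ls s * e1"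
          using n(1)[of s] V_pos[of ls s] ls_le by (intro mult_left_mono) auto
        also have "\<dots> \<le> v * e1" using Vv(2)[of s] e1 by (intro mult_right_mono) auto
        finally show "V ls s * (G n s - g s) \<le> v * e1" .
        show "(ls - l (k n)) * (\<rho> s * G n s) \<le> e1 * (r * m)"
          using n(2) G0[of n s] r(2)[of s] \<rho>(2)[of s] e1 r(1)
          by (intro mult_mono) auto
      qed
      also have "\<dots> = e1 * (v + r * m)" by (simp add: algebra_simps)
      also have "\<dots> \<le> e / 2 * d" by (rule e1')
      also have "\<dots> \<le> e / 2 * (\<kappa> * \<beta> s)" using e d by simp
      finally show "V (l (k n)) s * G n s - V ls s * g s \<le> e / 2 * (\<kappa> * \<beta> s)" .
    qed
    moreover have "g t \<le> G n t + e / 2" using n(1)[of t] unfolding e1_def by linarith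
    ultimately show "g t \<le> T (\<lambda>s. V ls s * g s) t + e" by linarith
  qed
  define h where "h = T (\<lambda>s. V ls s * g s)"
  have hC: "h \<in> Ck_circle 0" unfolding h_def by (intro T_Ck VM g)
  have gh: "g t \<le> h t" for t using sup_sol by (simp add: h_def)
  have Vls: "V ls t > 0" for t using V_pos ls_le by simp
  \<comment> \<open>If \<open>g\<close> and \<open>h\<close> differed, applying \<open>T\<close>
    once more would lift \<open>h\<close> by a uniformly positive amount, enough to keep
    \<open>h\<close> a subsolution for a value above \<open>ls\<close>.\<close>
  have "g = h"
  proof (rule ccontr)
    assume "g \<noteq> h"
    then obtain s1 where s1: "g s1 \<noteq> h s1" by auto
    define w where "w = T (\<lambda>s. V ls s * (h s + (- 1) * g s))"
    have hgC: "(\<lambda>s. h s + (- 1) * g s) \<in> Ck_circle 0"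
      by (intro Ck_circle_0_arith hC g Ck_circle_0_const)
    have wpos: "w t > 0" for t
      unfolding w_def
      by (rule T_pos[OF VM[OF hgC], where s = s1])
        (use gh Vls s1 in \<open>auto simp: less_imp_le less_imp_neq[THEN not_sym]\<close>)
    have wC: "w \<in> Ck_circle 0" unfolding w_def by (intro T_Ck VM hgC)
    obtain e where e: "e > 0" "\<And>t. e \<le> w t" using Ck_circle_0_pos_lower[OF wC wpos] by metis
    have w_eq: "T (\<lambda>s. V ls s * h s) t = h t + w t" for t
    proof -
      have "T (\<lambda>s. V ls s * h s + (- 1) * (V ls s * g s)) t = T (\<lambda>s. V ls s * h s) t - h t"
        using T_lin[OF VM[OF hC] VM[OF g], of ls "- 1" ls t] by (simp add: h_def)
      then show ?thesis by (simp add: w_def algebra_simps)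
    qed
    have rhC: "(\<lambda>s. \<rho> s * h s) \<in> Ck_circle 0" by (intro Ck_circle_0_arith \<rho> hC)
    obtain z where z: "z > 0" "\<And>t. \<bar>T (\<lambda>s. \<rho> s * h s) t\<bar> \<le> z"
      using Ck_circle_0_bounded[OF T_Ck[OF rhC]] by blast
    \<comment> \<open>The bound 1 keeps \<open>ls + y\<close> below the cap \<open>L + 1\<close>;
      the bound \<open>e / z\<close> keeps the loss \<open>y * T (\<rho> h)\<close> below the gain
      \<open>w \<ge> e\<close>.\<close>
    define y where "y = min 1 (e / z)"
    have y: "y > 0" "y \<le> 1" "y * z \<le> e" using e z by (auto simp: y_def min_def field_simps)
    have step: "h t \<le> T (\<lambda>s. V (ls + y) s * h s) t" for t
    proof -
      have "T (\<lambda>s. V (ls + y) s * h s) t = T (\<lambda>s. V ls s * h s + (- y) * (\<rho> s * h s)) t"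
        by (simp add: V_def algebra_simps)
      also have "\<dots> = h t + w t - y * T (\<lambda>s. \<rho> s * h s) t"
        using T_lin[OF VM[OF hC] rhC, of ls "- y" t] w_eq[of t] by simp
      finally have *: "T (\<lambda>s. V (ls + y) s * h s) t = h t + w t - y * T (\<lambda>s. \<rho> s * h s) t" .
      have "y * T (\<lambda>s. \<rho> s * h s) t \<le> y * z" using z(2)[of t] y by (intro mult_left_mono) auto
      then show ?thesis using * e(2)[of t] y(3) by linarith
    qed
    obtain s2 where s2: "\<And>t. h t \<le> h s2" using Ck_circle_0_attains_sup[OF hC] by metis
    have hs2: "h s2 > 0" using gs gh[of s] s2[of s] by linarith
    have "good (ls + y) (\<lambda>t. h t / h s2)"
      unfolding good_def
    proof (intro conjI allI)
      show "ls + y \<le> L + 1" using ls_le y by simp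
      show "(\<lambda>t. h t / h s2) \<in> Ck_circle 0"
        using hs2 by (intro Ck_circle_0_arith hC Ck_circle_0_const) simp
      show "\<exists>t. h t / h s2 = 1" using hs2 by (intro exI[of _ s2]) simp
      fix t
      show "0 \<le> h t / h s2" using gh[of t] g0[of t] hs2 by simp
      show "h t / h s2 \<le> 1" using s2[of t] hs2 by simp
      \<comment> \<open>The zero summand brings the rescaling into the form \<open>f + k * g\<close>
        of linearity; for the inequality needed, \<open>T 0 \<ge> 0\<close> is enough.\<close>
      have "T (\<lambda>s. 0 + (1 / h s2) * (V (ls + y) s * h s)) t =
          T (\<lambda>_. 0) t + (1 / h s2) * T (\<lambda>s. V (ls + y) s * h s) t"
        by (rule T_lin[OF Ck_circle_0_const VM[OF hC]])
      moreover have "T (\<lambda>_. 0) t \<ge> 0" by (rule T_nonneg) auto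
      ultimately show "h t / h s2 \<le> T (\<lambda>s. V (ls + y) s * (h s / h s2)) t"
        using divide_right_mono[OF step[of t], of "h s2"] hs2 by simp
    qed
    then have "ls + y \<le> ls" unfolding ls_def by (intro cSup_upper bdd) (auto simp: S_def)
    then show False using y by simp
  qed
  have "g t > 0" for t
    unfolding \<open>g = h\<close> unfolding h_def
    by (rule T_pos[OF VM[OF g], where s = s]) (use g0 Vls gs in \<open>auto simp: less_imp_le less_imp_neq[THEN not_sym]\<close>)
  moreover have "g = green \<kappa> \<beta> (\<lambda>t. (\<kappa> * \<beta> t + (c t - ls) * \<rho> t) * g t)"
    using \<open>g = h\<close> by (simp add: h_def T_def V_def)
  ultimately show ?thesis using that g by blast
qed

text \<open>The derivatives are explicit arguments, so that comparison arguments can use them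
  pointwise; continuity of \<open>\<phi>''\<close> is what membership in \<open>Ck_circle 2\<close>
  requires. The factor \<epsilon> is absorbed into \<open>\<alpha>\<close>.\<close>

definition positive_eigenfunction ::
  "(real \<Rightarrow> real) \<Rightarrow> (real \<Rightarrow> real) \<Rightarrow> (real \<Rightarrow> real) \<Rightarrow> real \<Rightarrow>
    (real \<Rightarrow> real) \<Rightarrow> (real \<Rightarrow> real) \<Rightarrow> (real \<Rightarrow> real) \<Rightarrow> bool" where
  "positive_eigenfunction \<alpha> b c l \<phi> \<phi>' \<phi>'' \<longleftrightarrow>
     periodic \<phi> \<and> continuous_on UNIV \<phi>'' \<and>
     (\<forall>t. \<phi> t > 0 \<and> (\<phi> has_real_derivative \<phi>' t) (at t) \<and> (\<phi>' has_real_derivative \<phi>'' t) (at t) \<and>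
       \<alpha> t * \<phi>'' t + b t * \<phi>' t + c t * \<phi> t = l * \<phi> t)"

text \<open>After division by \<open>\<alpha>\<close>, the fixed-point equation applies with
  \<open>\<beta> = \<kappa> + b / \<alpha>\<close> and \<open>\<rho> = 1 / \<alpha>\<close>,
  provided \<open>\<kappa>\<close> is large.\<close>

lemma positive_eigenfunction_exists:
  assumes \<alpha>: "\<alpha> \<in> Ck_circle 0" "\<And>t. \<alpha> t > 0" and b: "b \<in> Ck_circle 0" and c: "c \<in> Ck_circle 0"
  obtains l \<phi> \<phi>' \<phi>'' where "positive_eigenfunction \<alpha> b c l \<phi> \<phi>' \<phi>''"
proof -
  have \<alpha>0: "\<alpha> t \<noteq> 0" for t using \<alpha>(2)[of t] by simp
  obtain L where L: "\<And>t. c t \<le> L" using Ck_circle_0_attains_sup[OF c] by metis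
  define \<rho> where "\<rho> t = 1 / \<alpha> t" for t
  have \<rho>: "\<rho> \<in> Ck_circle 0" "\<And>t. \<rho> t > 0"
    unfolding \<rho>_def using \<alpha> by (auto intro!: Ck_circle_0_arith simp: \<alpha>0)
  define B where "B t = b t / \<alpha> t" for t
  have B: "B \<in> Ck_circle 0" unfolding B_def using \<alpha> b by (auto intro!: Ck_circle_0_arith simp: \<alpha>0)
  obtain m where m: "m > 0" "\<And>t. \<bar>B t\<bar> \<le> m" using Ck_circle_0_bounded[OF B] by metis
  have "(\<lambda>t. (c t - (L + 1)) * \<rho> t) \<in> Ck_circle 0"
    by (intro Ck_circle_0_arith c \<rho> Ck_circle_0_const)
  from Ck_circle_0_bounded[OF this]
  obtain x where x: "x > 0" "\<And>t. \<bar>(c t - (L + 1)) * \<rho> t\<bar> \<le> x" by metis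
  \<comment> \<open>The summand \<open>m\<close> absorbs \<open>B\<close>, leaving
    \<open>\<beta> \<ge> 1 + x\<close>; as also \<open>\<kappa> \<ge> 1\<close>, the product
    \<open>\<kappa> \<beta>\<close> exceeds \<open>x\<close>, the bound of the zeroth-order
    term.\<close>
  define \<kappa> where "\<kappa> = m + 1 + x"
  define \<beta> where "\<beta> t = \<kappa> + B t" for t
  have \<kappa>: "\<kappa> > 0" using m x by (simp add: \<kappa>_def)
  have \<beta>1: "\<beta> t \<ge> 1 + x" for t
    using m(2)[of t] unfolding \<beta>_def \<kappa>_def by linarith
  then have \<beta>: "\<beta> \<in> Ck_circle 0" "\<And>t. \<beta> t > 0"
    using x(1) unfolding \<beta>_def
    by (auto intro!: Ck_circle_0_arith B) (metis add_pos_pos less_le_trans zero_less_one)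
  have "\<kappa> * \<beta> t + (c t - (L + 1)) * \<rho> t > 0" for t
  proof -
    have "1 * (1 + x) \<le> \<kappa> * \<beta> t" using \<beta>1[of t] m x by (intro mult_mono) (auto simp: \<kappa>_def)
    moreover have "- x \<le> (c t - (L + 1)) * \<rho> t"
      using x(2)[of t] by (simp only: abs_le_iff minus_le_iff)
    ultimately have "1 * (1 + x) + (- x) \<le> \<kappa> * \<beta> t + (c t - (L + 1)) * \<rho> t"
      by (rule add_mono)
    then show ?thesis by (rule less_le_trans[rotated]) simp
  qed
  from green_fixed_point[OF \<beta> \<kappa> c \<rho> L this]
  obtain l g where g: "g \<in> Ck_circle 0" "\<And>t. g t > 0"
    and gfix: "g = green \<kappa> \<beta> (\<lambda>t. (\<kappa> * \<beta> t + (c t - l) * \<rho> t) * g t)" by blast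
  define f where "f t = (\<kappa> * \<beta> t + (c t - l) * \<rho> t) * g t" for t
  have f: "f \<in> Ck_circle 0"
    unfolding f_def by (intro Ck_circle_0_arith c \<rho> Ck_circle_0_const \<beta> g)
  have gf: "green \<kappa> \<beta> f = g" using gfix by (simp add: f_def[abs_def])
  define d where "d = decay_sol \<beta> f"
  have g': "(g has_real_derivative \<kappa> * g t - d t) (at t)" for t
    using green_DERIV[OF \<beta> \<kappa> f] by (simp add: gf d_def)
  have d': "(d has_real_derivative f t - \<beta> t * d t) (at t)" for t
    unfolding d_def by (rule decay_sol(2)[OF \<beta> f])
  define g1 where "g1 t = \<kappa> * g t - d t" for t
  define g2 where "g2 t = \<kappa> * g1 t - (f t - \<beta> t * d t)" for t
  have g1': "(g1 has_real_derivative g2 t) (at t)" for t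
    unfolding g1_def[abs_def] g2_def by (auto intro!: derivative_eq_intros g' d' simp: g1_def)
  have "continuous_on UNIV g2"
    unfolding g2_def
    using DERIV_imp_continuous_on[OF d'] DERIV_imp_continuous_on[OF g1'] f \<beta>
    by (auto intro!: continuous_intros simp: Ck_circle_0_iff)
  moreover have "\<alpha> t * g2 t + b t * g1 t + c t * g t = l * g t" for t
  proof -
    have "g2 t = \<kappa> * g1 t - f t + \<beta> t * (\<kappa> * g t - g1 t)" by (simp add: g2_def g1_def)
    then have g2: "g2 t = - (B t * g1 t) - (c t - l) * \<rho> t * g t"
      by (simp add: f_def \<beta>_def algebra_simps)
    have "\<alpha> t * g2 t = - (\<alpha> t * B t * g1 t) - (c t - l) * (\<alpha> t * \<rho> t) * g t"
      unfolding g2 by (simp add: algebra_simps)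
    also have "\<alpha> t * B t = b t" using \<alpha>0[of t] by (simp add: B_def)
    also have "\<alpha> t * \<rho> t = 1" using \<alpha>0[of t] by (simp add: \<rho>_def)
    finally show ?thesis by (simp add: algebra_simps)
  qed
  ultimately have "positive_eigenfunction \<alpha> b c l g g1 g2"
    unfolding positive_eigenfunction_def using g g' g1' by (auto simp: Ck_circle_0_iff g1_def)
  then show ?thesis by (rule that)
qed

subsection \<open>The principal eigenvalue\<close>

(* For eigenfunctions u = p + i q the quantity |u|^2 / phi^2 satisfies an elliptic inequality
   without zeroth-order term; h below is its derivative up to a positive factor. *)
lemma positive_eigenfunction_dominates:
  fixes p q :: "real \<Rightarrow> real"
  assumes \<alpha>: "\<alpha> \<in> Ck_circle 0" "\<And>t. \<alpha> t > 0" and b: "b \<in> Ck_circle 0"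
    and ef: "positive_eigenfunction \<alpha> b c l \<phi> \<phi>' \<phi>''"
    and per: "periodic p" "periodic q"
    and p: "\<And>t. (p has_real_derivative p' t) (at t)" "\<And>t. (p' has_real_derivative p'' t) (at t)"
    and q: "\<And>t. (q has_real_derivative q' t) (at t)" "\<And>t. (q' has_real_derivative q'' t) (at t)"
    and eqp: "\<And>t. \<alpha> t * p'' t + b t * p' t + c t * p t = x * p t - y * q t"
    and eqq: "\<And>t. \<alpha> t * q'' t + b t * q' t + c t * q t = x * q t + y * p t"
    and nz: "p t0 \<noteq> 0 \<or> q t0 \<noteq> 0" and x: "l \<le> x"
  shows "x = l" "y = 0"
proof -
  have \<phi>: "periodic \<phi>" "\<And>t. \<phi> t > 0"
    "\<And>t. (\<phi> has_real_derivative \<phi>' t) (at t)" "\<And>t. (\<phi>' has_real_derivative \<phi>'' t) (at t)"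
    "\<And>t. \<alpha> t * \<phi>'' t + b t * \<phi>' t + c t * \<phi> t = l * \<phi> t"
    using ef by (auto simp: positive_eigenfunction_def)
  have \<phi>0: "\<phi> t \<noteq> 0" for t using \<phi>(2)[of t] by simp
  have \<alpha>0: "\<alpha> t \<noteq> 0" for t using \<alpha>(2)[of t] by simp
  have C: "\<phi> \<in> Ck_circle 0" "p \<in> Ck_circle 0" "q \<in> Ck_circle 0"
    using \<phi>(1) per DERIV_imp_continuous_on[OF \<phi>(3)] DERIV_imp_continuous_on[OF p(1)]
      DERIV_imp_continuous_on[OF q(1)] by (auto simp: Ck_circle_0_iff)
  define N where "N t = (p t * p t + q t * q t) / (\<phi> t * \<phi> t)" for t
  have N: "N \<in> Ck_circle 0" unfolding N_def by (intro Ck_circle_0_arith C) (simp add: \<phi>0)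
  obtain s where s: "\<And>t. N t \<le> N s" using Ck_circle_0_attains_sup[OF N] by metis
  have Ns: "N s > 0"
  proof -
    have "p t0 * p t0 + q t0 * q t0 > 0" using nz by (simp add: sum_squares_gt_zero_iff)
    then have "N t0 > 0" using \<phi>(2)[of t0] by (simp add: N_def)
    then show ?thesis using s[of t0] by simp
  qed
  define r where "r t = \<phi>' t / \<phi> t" for t
  have r: "(r has_real_derivative \<phi>'' t / \<phi> t - r t * r t) (at t)" for t
    unfolding r_def using \<phi>0[of t]
    by (auto intro!: derivative_eq_intros \<phi> simp: field_simps)
  have "(\<lambda>t. b t / \<alpha> t) \<in> Ck_circle 0" using \<alpha> b by (auto intro!: Ck_circle_0_arith simp: \<alpha>0)
  then obtain G where G: "\<And>t. (G has_real_derivative b t / \<alpha> t) (at t)"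
    using antiderivative_exists[of "\<lambda>t. b t / \<alpha> t"] by (auto simp: Ck_circle_0_iff)
  \<comment> \<open>This is \<open>exp G * \<phi>^2 * N' / 2\<close>. Since
    \<open>G' = b / \<alpha>\<close>, the exponential removes the drift; in \<open>h'\<close> the
    terms with \<open>y\<close> cancel and the rest completes to the squares in
    \<open>src\<close>.\<close>
  define h where "h t = exp (G t) * (p t * p' t + q t * q' t - (p t * p t + q t * q t) * r t)" for t
  define src where "src t = (x - l) * (p t * p t + q t * q t) / \<alpha> t
      + (p' t - r t * p t)\<^sup>2 + (q' t - r t * q t)\<^sup>2" for t
  have h: "(h has_real_derivative exp (G t) * src t) (at t)" for t
  proof -
    have e1: "p'' t = (x * p t - y * q t - b t * p' t - c t * p t) / \<alpha> t"
      using eqp[of t] \<alpha>0[of t] by (simp add: field_simps)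
    have e2: "q'' t = (x * q t + y * p t - b t * q' t - c t * q t) / \<alpha> t"
      using eqq[of t] \<alpha>0[of t] by (simp add: field_simps)
    have e3: "\<phi>'' t / \<phi> t = (l - b t * r t - c t) / \<alpha> t"
      using \<phi>(5)[of t] \<alpha>0[of t] \<phi>0[of t] by (simp add: r_def field_simps)
    have "(h has_real_derivative
      exp (G t) * (b t / \<alpha> t * (p t * p' t + q t * q' t - (p t * p t + q t * q t) * r t)
        + (p' t * p' t + p t * p'' t + q' t * q' t + q t * q'' t
          - 2 * (p t * p' t + q t * q' t) * r t
          - (p t * p t + q t * q t) * (\<phi>'' t / \<phi> t - r t * r t)))) (at t)"
      unfolding h_def
      by (auto intro!: derivative_eq_intros G p q r simp: algebra_simps)
    moreover have "b t / \<alpha> t * (p t * p' t + q t * q' t - (p t * p t + q t * q t) * r t)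
        + (p' t * p' t + p t * p'' t + q' t * q' t + q t * q'' t
          - 2 * (p t * p' t + q t * q' t) * r t
          - (p t * p t + q t * q t) * (\<phi>'' t / \<phi> t - r t * r t)) = src t"
      unfolding e1 e2 e3 src_def using \<alpha>0[of t]
      by (simp add: field_simps power2_eq_square)
    ultimately show ?thesis by simp
  qed
  have src: "src t \<ge> 0" for t
    using x \<alpha>(2)[of t] by (simp add: src_def)
  have mono: "h u \<le> h v" if "u \<le> v" for u v
    using DERIV_nonneg_imp_nondecreasing[OF that, of h] h src by (meson exp_ge_zero mult_nonneg_nonneg)
  have h0: "h z = 0" if z: "N z = N s" for z
  proof -
    define D where "D t = N s * (\<phi> t * \<phi> t) - (p t * p t + q t * q t)" for t
    have D0: "D t \<ge> 0" for t
      using s[of t] \<phi>(2)[of t] by (simp add: D_def N_def pos_divide_le_eq)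
    have Dz: "D z = 0" using z \<phi>0[of z] by (simp add: D_def N_def field_simps flip: z)
    have D': "(D has_real_derivative 2 * N s * \<phi> z * \<phi>' z - 2 * (p z * p' z + q z * q' z)) (at z)"
      unfolding D_def by (auto intro!: derivative_eq_intros \<phi> p q simp: algebra_simps)
    have "2 * N s * \<phi> z * \<phi>' z - 2 * (p z * p' z + q z * q' z) = 0"
      by (rule DERIV_local_min[OF D' zero_less_one]) (simp add: D0 Dz)
    then have e: "p z * p' z + q z * q' z = N s * \<phi> z * \<phi>' z" by simp
    have "(p z * p z + q z * q z) * r z = N s * \<phi> z * \<phi>' z"
      unfolding z[symmetric] unfolding N_def r_def using \<phi>0[of z] by simp
    then show ?thesis using e by (simp add: h_def)
  qed
  \<comment> \<open>The translates of \<open>s\<close> by one period are maximum points too. The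
    monotone function \<open>h\<close> vanishes at both of them, hence in between, and so does its
    derivative.\<close>
  have Nper: "N (s + 1) = N s" "N (s - 1) = N s"
    using N periodicD[of N s] periodicD[of N "s - 1"] by (auto simp: Ck_circle_0_iff)
  have hz: "h t = 0" if "s - 1 < t" "t < s + 1" for t
    using mono[of "s - 1" t] mono[of t "s + 1"] that h0[OF Nper(1)] h0[OF Nper(2)] by simp
  have src0: "src t = 0" if "s - 1 < t" "t < s + 1" for t
  proof -
    have "(h has_real_derivative 0) (at t)"
      by (rule has_field_derivative_transform_within_open[of "\<lambda>_. 0" _ _ "{s - 1<..<s + 1}"])
        (use that hz in auto)
    then have "exp (G t) * src t = 0" using h DERIV_unique by blast
    then show ?thesis by simp
  qed
  have pq: "p' t = r t * p t" "q' t = r t * q t" if "s - 1 < t" "t < s + 1" for t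
  proof -
    have "(x - l) * (p t * p t + q t * q t) / \<alpha> t \<ge> 0" using x \<alpha>(2)[of t] by simp
    moreover have "(p' t - r t * p t)\<^sup>2 \<ge> 0" "(q' t - r t * q t)\<^sup>2 \<ge> 0" by simp_all
    ultimately have "(p' t - r t * p t)\<^sup>2 = 0" "(q' t - r t * q t)\<^sup>2 = 0"
      using src0[OF that] unfolding src_def by linarith+
    then show "p' t = r t * p t" "q' t = r t * q t" by auto
  qed
  \<comment> \<open>A function with \<open>w' = r w\<close> near \<open>s\<close> is locally a
    multiple of \<open>\<phi>\<close>, so it inherits the equation with eigenvalue \<open>l\<close>.
    For \<open>p\<close> and \<open>q\<close> this is then set against their own equations.\<close>
  have key: "\<alpha> s * w'' s + b s * w' s + c s * w s = l * w s"
    if w: "(w has_real_derivative w' s) (at s)" "(w' has_real_derivative w'' s) (at s)"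
      and wr: "\<And>t. s - 1 < t \<Longrightarrow> t < s + 1 \<Longrightarrow> w' t = r t * w t" for w w' w'' :: "real \<Rightarrow> real"
  proof -
    have "((\<lambda>t. r t * w t) has_real_derivative w'' s) (at s)"
      by (rule has_field_derivative_transform_within_open[OF w(2), of "{s - 1<..<s + 1}"])
        (use wr in auto)
    moreover have "((\<lambda>t. r t * w t) has_real_derivative
        (\<phi>'' s / \<phi> s - r s * r s) * w s + r s * w' s) (at s)"
      by (auto intro!: derivative_eq_intros r w)
    ultimately have "w'' s = (\<phi>'' s / \<phi> s - r s * r s) * w s + r s * w' s"
      by (rule DERIV_unique)
    also have "\<dots> = \<phi>'' s / \<phi> s * w s" using wr[of s] by (simp add: algebra_simps)
    finally have w2: "w'' s = \<phi>'' s / \<phi> s * w s" .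
    have "\<phi> s * (\<alpha> s * w'' s + b s * w' s + c s * w s)
        = (\<alpha> s * \<phi>'' s + b s * \<phi>' s + c s * \<phi> s) * w s"
      using wr[of s] \<phi>0[of s] by (simp add: w2 r_def field_simps)
    then show ?thesis using \<phi>(5)[of s] \<phi>0[of s] by simp
  qed
  have "x * p s - y * q s = l * p s" "x * q s + y * p s = l * q s"
    using key[where w = p and w' = p' and w'' = p'', OF p pq(1)]
      key[where w = q and w' = q' and w'' = q'', OF q pq(2)] eqp[of s] eqq[of s] by simp_all
  then have E: "(x - l) * p s = y * q s" "(x - l) * q s = - (y * p s)"
    by (simp_all add: algebra_simps)
  have pos: "p s * p s + q s * q s > 0"
    using Ns \<phi>(2)[of s] by (simp add: N_def zero_less_divide_iff)
  \<comment> \<open>The relations \<open>E\<close> are a linear system for \<open>(p s, q s)\<close>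
    with determinant \<open>(x - l)^2 + y^2\<close>. Since this vector is nonzero, two combinations
    isolate \<open>x - l\<close> and \<open>y\<close>.\<close>
  have "(x - l) * (p s * p s + q s * q s) = ((x - l) * p s) * p s + ((x - l) * q s) * q s"
    by (simp add: algebra_simps)
  also have "\<dots> = 0" unfolding E by (simp add: algebra_simps)
  finally show "x = l" using pos by auto
  have "y * (p s * p s + q s * q s) = - ((x - l) * q s) * p s + ((x - l) * p s) * q s"
    unfolding E by (simp add: algebra_simps)
  also have "\<dots> = 0" by (simp add: algebra_simps)
  finally show "y = 0" using pos by auto
qed

lemma nderiv_1: "nderiv 1 f = (\<lambda>t. vector_derivative f (at t))"
  and nderiv_2: "nderiv 2 f = (\<lambda>t. vector_derivative (nderiv 1 f) (at t))"
  by (simp_all add: nderiv_def numeral_2_eq_2)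

lemma Ck_circle_1D:
  assumes "f \<in> Ck_circle 1"
  shows "periodic f" "(f has_vector_derivative nderiv 1 f t) (at t)" "continuous_on UNIV (nderiv 1 f)"
  using assms by (auto simp: Ck_circle_def Ck_on_def nderiv_def vector_derivative_works)

lemma Ck_circle_2D:
  assumes "f \<in> Ck_circle 2"
  shows "f \<in> Ck_circle 1" "(nderiv 1 f has_vector_derivative nderiv 2 f t) (at t)"
    "continuous_on UNIV (nderiv 2 f)"
proof -
  have f: "periodic f" "\<And>j t. j < 2 \<Longrightarrow> nderiv j f differentiable (at t)" "continuous_on UNIV (nderiv 2 f)"
    using assms by (auto simp: Ck_circle_def Ck_on_def)
  show d: "(nderiv 1 f has_vector_derivative nderiv 2 f t) (at t)" for t
    unfolding nderiv_2 using f(2)[of 1 t] by (simp add: vector_derivative_works)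
  show "continuous_on UNIV (nderiv 2 f)" by (rule f(3))
  have "continuous_on UNIV (nderiv 1 f)"
    by (meson continuous_at_imp_continuous_on d has_vector_derivative_continuous)
  then show "f \<in> Ck_circle 1"
    using f(1) f(2)[of 0] by (auto simp: Ck_circle_def Ck_on_def)
qed

lemma positive_eigenfunction_is_eigenvalue:
  assumes "positive_eigenfunction (\<lambda>t. \<epsilon> * a t) b c l \<phi> \<phi>' \<phi>''"
  shows "is_eigenvalue a b c \<epsilon> (of_real l)"
proof -
  have \<phi>: "periodic \<phi>" "\<And>t. \<phi> t > 0" "continuous_on UNIV \<phi>''"
    "\<And>t. (\<phi> has_real_derivative \<phi>' t) (at t)" "\<And>t. (\<phi>' has_real_derivative \<phi>'' t) (at t)"
    "\<And>t. \<epsilon> * a t * \<phi>'' t + b t * \<phi>' t + c t * \<phi> t = l * \<phi> t"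
    using assms by (auto simp: positive_eigenfunction_def)
  define u :: "real \<Rightarrow> complex" where "u t = of_real (\<phi> t)" for t
  have u: "(u has_vector_derivative of_real (\<phi>' t)) (at t)"
    "((\<lambda>t. of_real (\<phi>' t) :: complex) has_vector_derivative of_real (\<phi>'' t)) (at t)" for t
    unfolding u_def has_vector_derivative_complex_iff using \<phi> by auto
  have n1: "nderiv 1 u = (\<lambda>t. of_real (\<phi>' t))"
    unfolding nderiv_1 by (intro ext vector_derivative_at u)
  have n2: "nderiv 2 u = (\<lambda>t. of_real (\<phi>'' t))"
    unfolding nderiv_2 n1 by (intro ext vector_derivative_at u)
  have "nderiv j u differentiable (at t)" if "j < 2" for j t
  proof -
    have "j = 0 \<or> j = 1" using that by auto
    then show ?thesis
    proof
      assume "j = 1"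
      then show ?thesis by (simp only: n1) (rule differentiableI_vector[OF u(2)])
    qed (simp add: nderiv_def differentiableI_vector[OF u(1)])
  qed
  moreover have "periodic u" using \<phi>(1) by (simp add: periodic_def u_def)
  ultimately have "u \<in> Ck_circle 2"
    using \<phi>(3) by (auto simp: Ck_circle_def Ck_on_def n2 intro!: continuous_intros)
  moreover have "u t \<noteq> 0" for t using \<phi>(2)[of t] by (simp add: u_def)
  moreover have "(\<epsilon> * a t) *\<^sub>R nderiv 2 u t + b t *\<^sub>R nderiv 1 u t + c t *\<^sub>R u t = of_real l * u t" for t
    unfolding n1 n2 u_def scaleR_conv_of_real
    using \<phi>(6)[of t] by (metis of_real_add of_real_mult)
  ultimately show ?thesis unfolding is_eigenvalue_def by blast
qed

text \<open>Domination says that an eigenvalue with real part at least \<open>l\<close> equals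
  \<open>l\<close>. This gives maximality and also the uniqueness that \<open>THE\<close>
  requires.\<close>

lemma principal_eigenvalue_eqI:
  assumes a: "a \<in> Ck_circle 0" "\<And>t. a t > 0" and b: "b \<in> Ck_circle 0" and \<epsilon>: "\<epsilon> > 0"
    and ef: "positive_eigenfunction (\<lambda>t. \<epsilon> * a t) b c l \<phi> \<phi>' \<phi>''"
  shows "principal_eigenvalue a b c \<epsilon> = l"
proof -
  have *: "z = of_real l" if ev: "is_eigenvalue a b c \<epsilon> z" and z: "l \<le> Re z" for z
  proof -
    obtain u :: "real \<Rightarrow> complex" and t0 where u: "u \<in> Ck_circle 2" "u t0 \<noteq> 0"
      and eq: "\<And>t. (\<epsilon> * a t) *\<^sub>R nderiv 2 u t + b t *\<^sub>R nderiv 1 u t + c t *\<^sub>R u t = z * u t"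
      using ev by (auto simp: is_eigenvalue_def)
    note u1 = Ck_circle_1D[OF Ck_circle_2D(1)[OF u(1)]]
    have d1: "((\<lambda>t. Re (u t)) has_real_derivative Re (nderiv 1 u t)) (at t)"
      "((\<lambda>t. Im (u t)) has_real_derivative Im (nderiv 1 u t)) (at t)"
      "((\<lambda>t. Re (nderiv 1 u t)) has_real_derivative Re (nderiv 2 u t)) (at t)"
      "((\<lambda>t. Im (nderiv 1 u t)) has_real_derivative Im (nderiv 2 u t)) (at t)" for t
      using u1(2)[of t] Ck_circle_2D(2)[OF u(1), of t] unfolding has_vector_derivative_complex_iff by auto
    have per: "periodic (\<lambda>t. Re (u t))" "periodic (\<lambda>t. Im (u t))"
      using u1(1) by (auto simp: periodic_def)
    have ea: "(\<lambda>t. \<epsilon> * a t) \<in> Ck_circle 0" by (intro Ck_circle_0_arith a Ck_circle_0_const)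
    have ea0: "\<epsilon> * a t > 0" for t using a \<epsilon> by simp
    have e1: "\<epsilon> * a t * Re (nderiv 2 u t) + b t * Re (nderiv 1 u t) + c t * Re (u t)
        = Re z * Re (u t) - Im z * Im (u t)" for t
      using arg_cong[OF eq[of t], of Re] by simp
    have e2: "\<epsilon> * a t * Im (nderiv 2 u t) + b t * Im (nderiv 1 u t) + c t * Im (u t)
        = Re z * Im (u t) + Im z * Re (u t)" for t
      using arg_cong[OF eq[of t], of Im] by simp
    have nz: "Re (u t0) \<noteq> 0 \<or> Im (u t0) \<noteq> 0" using u(2) by (simp add: complex_eq_iff)
    have "Re z = l" "Im z = 0"
      using positive_eigenfunction_dominates[OF ea ea0 b ef per d1(1,3,2,4) e1 e2 nz z] by auto
    then show ?thesis by (simp add: complex_eq_iff)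
  qed
  have "(THE z. is_eigenvalue a b c \<epsilon> z \<and> (\<forall>z'. is_eigenvalue a b c \<epsilon> z' \<longrightarrow> Re z' \<le> Re z)) = of_real l"
  proof (rule the_equality)
    show "is_eigenvalue a b c \<epsilon> (of_real l) \<and>
        (\<forall>z'. is_eigenvalue a b c \<epsilon> z' \<longrightarrow> Re z' \<le> Re (complex_of_real l))"
      using positive_eigenfunction_is_eigenvalue[OF ef] * by (metis Re_complex_of_real linear)
    show "z = of_real l"
      if "is_eigenvalue a b c \<epsilon> z \<and> (\<forall>z'. is_eigenvalue a b c \<epsilon> z' \<longrightarrow> Re z' \<le> Re z)" for z
      using that positive_eigenfunction_is_eigenvalue[OF ef] * by (metis Re_complex_of_real)
  qed
  then show ?thesis by (simp add: principal_eigenvalue_def)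
qed

subsection \<open>Comparison with sub- and supersolutions\<close>

text \<open>Were \<open>d''\<close> negative, \<open>d'\<close> would be negative just to the right
  of its zero \<open>s\<close>, and \<open>d\<close> would drop below its minimum.\<close>

lemma second_derivative_test:
  fixes d :: "real \<Rightarrow> real"
  assumes e: "0 < e" and nn: "\<And>t. \<bar>t - s\<bar> < e \<Longrightarrow> d t \<ge> d s"
    and d: "\<And>t. \<bar>t - s\<bar> < e \<Longrightarrow> (d has_real_derivative d' t) (at t)"
    and d': "(d' has_real_derivative d'') (at s)"
  shows "d' s = 0" "d'' \<ge> 0"
proof -
  show d0: "d' s = 0"
    using DERIV_local_min[OF d[of s] e] nn e by (simp add: abs_minus_commute)
  show "d'' \<ge> 0"
  proof (rule ccontr)
    assume "\<not> d'' \<ge> 0"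
    then obtain r where r: "r > 0" "\<And>h. 0 < h \<Longrightarrow> h < r \<Longrightarrow> d' (s + h) < d' s"
      using DERIV_neg_dec_right[OF d'] by auto
    define h where "h = min (r / 2) (e / 2)"
    have h: "0 < h" "h < r" "h < e" using r e by (auto simp: h_def min_def)
    have "continuous_on {s..s + h} d"
      by (rule DERIV_continuous_on[of _ _ d'], rule has_field_derivative_at_within, rule d)
        (use h in auto)
    then have "d (s + h) < d s"
    proof (rule DERIV_neg_imp_decreasing_open[rotated 2])
      show "\<exists>y. (d has_real_derivative y) (at x) \<and> y < 0" if "s < x" "x < s + h" for x
        using d[of x] r(2)[of "x - s"] that h d0 by (intro exI[of _ "d' x"]) auto
    qed (use h in auto)
    then show False using nn[of "s + h"] h by simp
  qed
qed

text \<open>The least multiple of \<open>\<psi>\<close> above \<open>\<phi>\<close> touches it at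
  some point. There the first derivatives agree and the second ones are ordered, so only the
  eigenvalue terms remain to be compared.\<close>

lemma supersolution_bound:
  assumes \<alpha>: "\<And>t. \<alpha> t > 0"
    and ef: "positive_eigenfunction \<alpha> b c l \<phi> \<phi>' \<phi>''"
    and \<psi>: "periodic \<psi>" "\<And>t. \<psi> t > 0"
    "\<And>t. (\<psi> has_real_derivative \<psi>' t) (at t)" "\<And>t. (\<psi>' has_real_derivative \<psi>'' t) (at t)"
    "\<And>t. \<alpha> t * \<psi>'' t + b t * \<psi>' t + c t * \<psi> t \<le> \<mu> * \<psi> t"
  shows "l \<le> \<mu>"
proof -
  have \<phi>: "periodic \<phi>" "\<And>t. \<phi> t > 0"
    "\<And>t. (\<phi> has_real_derivative \<phi>' t) (at t)" "\<And>t. (\<phi>' has_real_derivative \<phi>'' t) (at t)"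
    "\<And>t. \<alpha> t * \<phi>'' t + b t * \<phi>' t + c t * \<phi> t = l * \<phi> t"
    using ef by (auto simp: positive_eigenfunction_def)
  have \<psi>0: "\<psi> t \<noteq> 0" for t using \<psi>(2)[of t] by simp
  have "\<phi> \<in> Ck_circle 0" "\<psi> \<in> Ck_circle 0"
    using \<phi>(1) \<psi>(1) DERIV_imp_continuous_on[OF \<phi>(3)] DERIV_imp_continuous_on[OF \<psi>(3)]
    by (auto simp: Ck_circle_0_iff)
  then have "(\<lambda>t. \<phi> t / \<psi> t) \<in> Ck_circle 0" by (rule Ck_circle_0_arith(5)) (rule \<psi>0)
  from Ck_circle_0_attains_sup[OF this]
  obtain s where s: "\<And>t. \<phi> t / \<psi> t \<le> \<phi> s / \<psi> s" by blast
  define k where "k = \<phi> s / \<psi> s"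
  define d where "d t = k * \<psi> t - \<phi> t" for t
  have d: "d t \<ge> 0" for t
    using s[of t] \<psi>(2)[of t] by (simp add: d_def k_def pos_divide_le_eq)
  have ds: "d s = 0" using \<psi>0[of s] by (simp add: d_def k_def)
  have d1: "(d has_real_derivative k * \<psi>' t - \<phi>' t) (at t)" for t
    unfolding d_def by (auto intro!: derivative_eq_intros \<phi> \<psi>)
  have d2: "((\<lambda>t. k * \<psi>' t - \<phi>' t) has_real_derivative k * \<psi>'' s - \<phi>'' s) (at s)"
    by (auto intro!: derivative_eq_intros \<phi> \<psi>)
  have "k * \<psi>' s - \<phi>' s = 0" "k * \<psi>'' s - \<phi>'' s \<ge> 0"
    using second_derivative_test[OF zero_less_one _ d1 d2] d ds by auto
  then have "\<alpha> s * (k * \<psi>'' s - \<phi>'' s) + b s * (k * \<psi>' s - \<phi>' s) \<ge> 0" using \<alpha>[of s] by simp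
  moreover have "\<alpha> s * (k * \<psi>'' s - \<phi>'' s) + b s * (k * \<psi>' s - \<phi>' s) + c s * d s
      = k * (\<alpha> s * \<psi>'' s + b s * \<psi>' s + c s * \<psi> s) - l * \<phi> s"
    by (simp add: d_def algebra_simps flip: \<phi>(5))
  moreover have "k * (\<alpha> s * \<psi>'' s + b s * \<psi>' s + c s * \<psi> s) \<le> k * (\<mu> * \<psi> s)"
    using \<psi>(2)[of s] \<phi>(2)[of s] by (intro mult_left_mono \<psi>) (simp add: k_def)
  moreover have "k * (\<mu> * \<psi> s) = \<mu> * \<phi> s" using \<psi>0[of s] by (simp add: k_def)
  ultimately have "l * \<phi> s \<le> \<mu> * \<phi> s" using ds by simp
  then show ?thesis using \<phi>(2)[of s] by simp
qed

text \<open>Here a multiple of \<open>\<phi>\<close> touches \<open>\<psi>\<close> from above. The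
  signs of \<open>\<psi>\<close> at the centre and at the endpoints force the contact into the
  interior of the interval, where \<open>\<psi>\<close> is positive.\<close>

lemma local_subsolution_bound:
  assumes \<alpha>: "\<And>t. \<alpha> t > 0"
    and ef: "positive_eigenfunction \<alpha> b c l \<phi> \<phi>' \<phi>''"
    and r: "r > 0" and cont: "continuous_on {p - r..p + r} \<psi>"
    and \<psi>: "\<psi> p > 0" "\<psi> (p - r) \<le> 0" "\<psi> (p + r) \<le> 0"
    "\<And>t. \<bar>t - p\<bar> < r \<Longrightarrow> (\<psi> has_real_derivative \<psi>' t) (at t)"
    "\<And>t. \<bar>t - p\<bar> < r \<Longrightarrow> (\<psi>' has_real_derivative \<psi>'' t) (at t)"
    "\<And>t. \<bar>t - p\<bar> < r \<Longrightarrow> \<alpha> t * \<psi>'' t + b t * \<psi>' t + c t * \<psi> t \<ge> \<mu> * \<psi> t"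
  shows "\<mu> \<le> l"
proof -
  have \<phi>: "periodic \<phi>" "\<And>t. \<phi> t > 0"
    "\<And>t. (\<phi> has_real_derivative \<phi>' t) (at t)" "\<And>t. (\<phi>' has_real_derivative \<phi>'' t) (at t)"
    "\<And>t. \<alpha> t * \<phi>'' t + b t * \<phi>' t + c t * \<phi> t = l * \<phi> t"
    using ef by (auto simp: positive_eigenfunction_def)
  have \<phi>0: "\<phi> t \<noteq> 0" for t using \<phi>(2)[of t] by simp
  have "continuous_on {p - r..p + r} (\<lambda>t. \<psi> t / \<phi> t)"
    by (intro continuous_intros cont DERIV_imp_continuous_on[OF \<phi>(3)]) (simp add: \<phi>0)
  then obtain s where s: "s \<in> {p - r..p + r}"
    "\<And>t. t \<in> {p - r..p + r} \<Longrightarrow> \<psi> t / \<phi> t \<le> \<psi> s / \<phi> s"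
    using continuous_attains_sup[of "{p - r..p + r}" "\<lambda>t. \<psi> t / \<phi> t"] r by fastforce
  define k where "k = \<psi> s / \<phi> s"
  have "\<psi> p / \<phi> p > 0" using \<psi>(1) \<phi>(2)[of p] by simp
  then have k: "k > 0" using s(2)[of p] r by (simp add: k_def)
  then have ps: "\<psi> s > 0" using \<phi>(2)[of s] by (simp add: k_def zero_less_divide_iff)
  define e where "e = r - \<bar>s - p\<bar>"
  have "s \<noteq> p - r" "s \<noteq> p + r" using ps \<psi>(2,3) by auto
  then have e: "e > 0" using s(1) by (auto simp: e_def abs_if)
  have near: "\<bar>t - p\<bar> < r" if "\<bar>t - s\<bar> < e" for t using that by (simp add: e_def)
  define d where "d t = k * \<phi> t - \<psi> t" for t
  have ds: "d s = 0" using \<phi>0[of s] by (simp add: d_def k_def)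
  have d: "d t \<ge> d s" if "\<bar>t - s\<bar> < e" for t
  proof -
    have "t \<in> {p - r..p + r}" using near[OF that] by auto
    then show ?thesis
      using s(2)[of t] \<phi>(2)[of t] ds by (simp add: d_def k_def pos_divide_le_eq)
  qed
  have d1: "(d has_real_derivative k * \<phi>' t - \<psi>' t) (at t)" if "\<bar>t - s\<bar> < e" for t
    unfolding d_def by (auto intro!: derivative_eq_intros \<phi> \<psi> near[OF that])
  have d2: "((\<lambda>t. k * \<phi>' t - \<psi>' t) has_real_derivative k * \<phi>'' s - \<psi>'' s) (at s)"
    using near[of s] e by (auto intro!: derivative_eq_intros \<phi> \<psi>)
  have "k * \<phi>' s - \<psi>' s = 0" "k * \<phi>'' s - \<psi>'' s \<ge> 0"
    using second_derivative_test[OF e d d1 d2] by auto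
  then have "\<alpha> s * (k * \<phi>'' s - \<psi>'' s) + b s * (k * \<phi>' s - \<psi>' s) \<ge> 0" using \<alpha>[of s] by simp
  moreover have "\<alpha> s * (k * \<phi>'' s - \<psi>'' s) + b s * (k * \<phi>' s - \<psi>' s) + c s * d s
      = k * (l * \<phi> s) - (\<alpha> s * \<psi>'' s + b s * \<psi>' s + c s * \<psi> s)"
    by (simp add: d_def algebra_simps flip: \<phi>(5))
  moreover have "\<alpha> s * \<psi>'' s + b s * \<psi>' s + c s * \<psi> s \<ge> \<mu> * \<psi> s"
    using near[of s] e by (intro \<psi>) simp
  moreover have "k * (l * \<phi> s) = l * \<psi> s" using \<phi>0[of s] by (simp add: k_def)
  ultimately have "\<mu> * \<psi> s \<le> l * \<psi> s" using ds by simp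
  then show ?thesis using ps by simp
qed

subsection \<open>The lower bound\<close>

(* Blow-up at scale sqrt eps around a zero p of b: in the variable y = (t - p) / sqrt eps the
   operator tends to a(p) u'' + beta y u' + c(p) u with beta = b'(p), and conjugation with the
   Gaussian exp (- kappa y^2 / 2), kappa = max 0 beta / a(p), turns beta into - |beta|. *)
lemma eigenvalue_lower_bound:
  assumes a: "a \<in> Ck_circle 0" "\<And>t. a t > 0" and c: "c \<in> Ck_circle 0"
    and b: "(b has_real_derivative \<beta>) (at p)" "b p = 0" and \<eta>: "\<eta> > 0"
  shows "\<exists>\<epsilon>0>0. \<forall>\<epsilon> l \<phi> \<phi>' \<phi>''. 0 < \<epsilon> \<and> \<epsilon> < \<epsilon>0 \<and>
    positive_eigenfunction (\<lambda>t. \<epsilon> * a t) b c l \<phi> \<phi>' \<phi>'' \<longrightarrow> c p - max 0 \<beta> - \<eta> \<le> l"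
proof -
  define a0 where "a0 = a p"
  have a0: "a0 > 0" using a by (simp add: a0_def)
  \<comment> \<open>The bump is \<open>(1 - \<rho> y^2)^2\<close> on
    \<open>\<bar>y\<bar> \<le> R\<close>. Squaring makes its second derivative positive near the
    ends, where the bump vanishes; near the centre \<open>a0 * v2 \<ge> - \<eta> / 8\<close> is
    small against \<open>\<eta> * v\<close>. The factor 32 yields
    \<open>a0 * v2 + \<eta> * v \<ge> \<eta> / 8\<close> throughout.\<close>
  define \<rho> where "\<rho> = \<eta> / (32 * a0)"
  have \<rho>: "\<rho> > 0" using \<eta> a0 by (simp add: \<rho>_def)
  have a0\<rho>: "a0 * \<rho> = \<eta> / 32" using a0 by (simp add: \<rho>_def)
  define R where "R = 1 / sqrt \<rho>"
  have R: "R > 0" "\<rho> * R\<^sup>2 = 1" using \<rho> by (auto simp: R_def power_divide)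
  define \<kappa> where "\<kappa> = max 0 \<beta> / a0"
  have \<kappa>: "\<kappa> \<ge> 0" "a0 * \<kappa> = max 0 \<beta>" "\<kappa> * (max 0 \<beta> - \<beta>) = 0"
    using a0 by (auto simp: \<kappa>_def max_def)
  define v where "v y = (1 - \<rho> * y\<^sup>2)\<^sup>2" for y
  define v1 where "v1 y = - 4 * \<rho> * y * (1 - \<rho> * y\<^sup>2)" for y
  define v2 where "v2 y = - 4 * \<rho> + 12 * \<rho>\<^sup>2 * y\<^sup>2" for y
  have v: "(v has_real_derivative v1 y) (at y)" "(v1 has_real_derivative v2 y) (at y)" for y
    unfolding v_def[abs_def] v1_def[abs_def] v2_def
    by (auto intro!: derivative_eq_intros simp: algebra_simps power2_eq_square)
  define E where "E y = exp (- (\<kappa> * y\<^sup>2 / 2))" for y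
  have E: "(E has_real_derivative - \<kappa> * y * E y) (at y)" for y
    unfolding E_def by (auto intro!: derivative_eq_intros)
  define \<Psi> where "\<Psi> y = E y * v y" for y
  define \<Psi>1 where "\<Psi>1 y = E y * (v1 y - \<kappa> * y * v y)" for y
  define \<Psi>2 where "\<Psi>2 y = E y * (v2 y - 2 * \<kappa> * y * v1 y - \<kappa> * v y + \<kappa>\<^sup>2 * y\<^sup>2 * v y)" for y
  have \<Psi>: "(\<Psi> has_real_derivative \<Psi>1 y) (at y)" "(\<Psi>1 has_real_derivative \<Psi>2 y) (at y)" for y
    unfolding \<Psi>_def[abs_def] \<Psi>1_def[abs_def] \<Psi>2_def
    by (auto intro!: derivative_eq_intros v E simp: algebra_simps power2_eq_square)
  have \<Psi>_cont: "continuous_on S \<Psi>" "continuous_on S \<Psi>1" "continuous_on S \<Psi>2" for S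
    unfolding \<Psi>_def \<Psi>1_def \<Psi>2_def E_def v_def v1_def v2_def by (intro continuous_intros; simp)+
  define \<delta> where "\<delta> = exp (- (\<kappa> * R\<^sup>2 / 2)) * (\<eta> / 8)"
  have \<delta>: "\<delta> > 0" using \<eta> by (simp add: \<delta>_def)
  have main: "a0 * \<Psi>2 y + \<beta> * y * \<Psi>1 y + (max 0 \<beta> + \<eta>) * \<Psi> y \<ge> \<delta>" if y: "\<bar>y\<bar> \<le> R" for y
  proof -
    have y2: "y\<^sup>2 \<le> R\<^sup>2" using y R by (simp add: abs_le_square_iff[symmetric])
    then have q1: "\<rho> * y\<^sup>2 \<le> 1" using R(2) \<rho> by (metis mult_left_mono less_imp_le)
    have "a0 * \<Psi>2 y + \<beta> * y * \<Psi>1 y + (max 0 \<beta> + \<eta>) * \<Psi> y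
        = E y * (a0 * v2 y - (2 * (a0 * \<kappa>) - \<beta>) * y * v1 y + \<eta> * v y
            + (max 0 \<beta> - a0 * \<kappa>) * v y + (\<kappa> * (a0 * \<kappa> - \<beta>)) * y\<^sup>2 * v y)"
      by (simp add: \<Psi>_def \<Psi>1_def \<Psi>2_def algebra_simps power2_eq_square)
    \<comment> \<open>The choice of \<open>\<kappa>\<close> cancels the last two terms, and
      \<open>2 * max 0 \<beta> - \<beta> = \<bar>\<beta>\<bar>\<close>.\<close>
    also have "\<dots> = E y * (a0 * v2 y - \<bar>\<beta>\<bar> * y * v1 y + \<eta> * v y)"
      unfolding \<kappa>(2) \<kappa>(3) by (simp add: max_def abs_if)
    finally have eq: "a0 * \<Psi>2 y + \<beta> * y * \<Psi>1 y + (max 0 \<beta> + \<eta>) * \<Psi> y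
        = E y * (a0 * v2 y - \<bar>\<beta>\<bar> * y * v1 y + \<eta> * v y)" .
    have "- \<bar>\<beta>\<bar> * y * v1 y = 4 * \<bar>\<beta>\<bar> * (\<rho> * y\<^sup>2) * (1 - \<rho> * y\<^sup>2)"
      by (simp add: v1_def algebra_simps power2_eq_square)
    also have "\<dots> \<ge> 0" using q1 \<rho> by simp
    finally have 1: "- \<bar>\<beta>\<bar> * y * v1 y \<ge> 0" .
    have "a0 * v2 y + \<eta> * v y = (a0 * \<rho>) * (12 * (\<rho> * y\<^sup>2) - 4) + \<eta> * (1 - \<rho> * y\<^sup>2)\<^sup>2"
      by (simp add: v2_def v_def algebra_simps power2_eq_square)
    also have "\<dots> = \<eta> * ((1 - \<rho> * y\<^sup>2 - 3 / 16)\<^sup>2 + 55 / 256)"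
      unfolding a0\<rho> by (simp add: field_simps power2_eq_square)
    also have "\<dots> \<ge> \<eta> * (1 / 8)"
      using \<eta> by (intro mult_left_mono) (simp_all add: add_increasing)
    finally have 2: "a0 * v2 y + \<eta> * v y \<ge> \<eta> / 8" by simp
    have "exp (- (\<kappa> * R\<^sup>2 / 2)) \<le> E y"
      using y2 \<kappa>(1) by (simp add: E_def mult_left_mono)
    then have "\<delta> \<le> E y * (a0 * v2 y - \<bar>\<beta>\<bar> * y * v1 y + \<eta> * v y)"
      unfolding \<delta>_def using 1 2 \<eta> by (intro mult_mono) (auto simp: E_def)
    then show ?thesis by (simp only: eq)
  qed
  have "continuous_on {- R..R} (\<lambda>y. \<bar>\<Psi> y\<bar> + \<bar>\<Psi>1 y\<bar> + \<bar>\<Psi>2 y\<bar>)"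
    by (intro continuous_intros \<Psi>_cont)
  then obtain y0 where y0: "\<And>y. y \<in> {- R..R} \<Longrightarrow>
      \<bar>\<Psi> y\<bar> + \<bar>\<Psi>1 y\<bar> + \<bar>\<Psi>2 y\<bar> \<le> \<bar>\<Psi> y0\<bar> + \<bar>\<Psi>1 y0\<bar> + \<bar>\<Psi>2 y0\<bar>"
    using continuous_attains_sup[of "{- R..R}"] R by fastforce
  define K where "K = \<bar>\<Psi> y0\<bar> + \<bar>\<Psi>1 y0\<bar> + \<bar>\<Psi>2 y0\<bar> + 1"
  have K: "K > 0" by (simp add: K_def)
  have \<Psi>K: "\<bar>\<Psi> y\<bar> \<le> K" "\<bar>\<Psi>1 y\<bar> \<le> K" "\<bar>\<Psi>2 y\<bar> \<le> K" if "\<bar>y\<bar> \<le> R" for y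
    using y0[of y] that by (auto simp: K_def abs_le_iff)
  \<comment> \<open>Freezing \<open>a\<close> and \<open>c\<close> costs at most
    \<open>\<tau> * K\<close> each, and linearizing \<open>b\<close> costs
    \<open>\<tau> * R * K\<close>; together they use up exactly the margin
    \<open>\<delta>\<close>.\<close>
  define \<tau> where "\<tau> = \<delta> / (K * (2 + R))"
  have \<tau>: "\<tau> > 0" "\<tau> * (K * (2 + R)) = \<delta>" using \<delta> K R by (auto simp: \<tau>_def)
  have isc: "isCont a p" "isCont c p"
    using a(1) c by (auto simp: Ck_circle_0_iff continuous_on_eq_continuous_at)
  have ev: "\<forall>\<^sub>F t in at p. \<bar>a t - a0\<bar> < \<tau>" "\<forall>\<^sub>F t in at p. \<bar>c t - c p\<bar> < \<tau>"
    "\<forall>\<^sub>F t in at p. \<bar>(b t - b p) / (t - p) - \<beta>\<bar> < \<tau>"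
    using isc b(1) \<tau>(1) unfolding isCont_def has_field_derivative_iff tendsto_iff
    by (auto simp: dist_real_def a0_def)
  have "\<forall>\<^sub>F t in at p. \<bar>a t - a0\<bar> < \<tau> \<and> \<bar>c t - c p\<bar> < \<tau> \<and> \<bar>(b t - b p) / (t - p) - \<beta>\<bar> < \<tau>"
    by (intro eventually_conj ev)
  then obtain d where d: "d > 0" "\<And>t. t \<noteq> p \<Longrightarrow> \<bar>t - p\<bar> < d \<Longrightarrow>
      \<bar>a t - a0\<bar> < \<tau> \<and> \<bar>c t - c p\<bar> < \<tau> \<and> \<bar>(b t - b p) / (t - p) - \<beta>\<bar> < \<tau>"
    unfolding eventually_at dist_real_def by auto
  have near: "\<bar>a t - a0\<bar> \<le> \<tau>" "\<bar>c t - c p\<bar> \<le> \<tau>" "\<bar>b t - \<beta> * (t - p)\<bar> \<le> \<tau> * \<bar>t - p\<bar>"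
    if t: "\<bar>t - p\<bar> < d" for t
  proof -
    have "\<bar>a t - a0\<bar> \<le> \<tau> \<and> \<bar>c t - c p\<bar> \<le> \<tau> \<and> \<bar>b t - \<beta> * (t - p)\<bar> \<le> \<tau> * \<bar>t - p\<bar>"
    proof (cases "t = p")
      case True
      then show ?thesis using \<tau> b(2) by (simp add: a0_def)
    next
      case False
      have "b t - \<beta> * (t - p) = ((b t - b p) / (t - p) - \<beta>) * (t - p)"
        using False b(2) by (simp add: field_simps)
      then have "\<bar>b t - \<beta> * (t - p)\<bar> = \<bar>(b t - b p) / (t - p) - \<beta>\<bar> * \<bar>t - p\<bar>"
        by (simp only: abs_mult)
      also have "\<dots> \<le> \<tau> * \<bar>t - p\<bar>" using d(2)[OF False t] by (intro mult_right_mono) auto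
      finally show ?thesis using d(2)[OF False t] by simp
    qed
    then show "\<bar>a t - a0\<bar> \<le> \<tau>" "\<bar>c t - c p\<bar> \<le> \<tau>" "\<bar>b t - \<beta> * (t - p)\<bar> \<le> \<tau> * \<bar>t - p\<bar>"
      by auto
  qed
  show ?thesis
  \<comment> \<open>This threshold means \<open>R * sqrt \<epsilon> < d\<close>: the rescaled bump
    lives where the coefficients are within \<open>\<tau>\<close> of their linearization.\<close>
  proof (intro exI[of _ "(d / R)\<^sup>2"] conjI allI impI)
    show "0 < (d / R)\<^sup>2" using d(1) R by simp
    fix \<epsilon> l :: real and \<phi> \<phi>' \<phi>''
    assume *: "0 < \<epsilon> \<and> \<epsilon> < (d / R)\<^sup>2 \<and> positive_eigenfunction (\<lambda>t. \<epsilon> * a t) b c l \<phi> \<phi>' \<phi>''"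
    define s where "s = sqrt \<epsilon>"
    have s: "s > 0" "s * s = \<epsilon>" using * by (auto simp: s_def)
    have "s < d / R"
      unfolding s_def using * d(1) R by (intro real_less_lsqrt) auto
    then have Rs: "R * s < d" using R by (simp add: field_simps)
    show "c p - max 0 \<beta> - \<eta> \<le> l"
    proof (rule local_subsolution_bound[where p = p and r = "R * s" and
          \<psi> = "\<lambda>t. \<Psi> ((t - p) / s)" and \<psi>' = "\<lambda>t. \<Psi>1 ((t - p) / s) / s" and
          \<psi>'' = "\<lambda>t. \<Psi>2 ((t - p) / s) / s / s"])
      show "0 < \<epsilon> * a t" for t using * a(2)[of t] by simp
      show "positive_eigenfunction (\<lambda>t. \<epsilon> * a t) b c l \<phi> \<phi>' \<phi>''" using * by simp
      show "0 < R * s" using R s by simp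
      have y': "((\<lambda>t. (t - p) / s) has_real_derivative 1 / s) (at t)" for t
        using s(1) by (auto intro!: derivative_eq_intros)
      have d1: "((\<lambda>t. \<Psi> ((t - p) / s)) has_real_derivative \<Psi>1 ((t - p) / s) / s) (at t)" for t
        using DERIV_chain2[OF \<Psi>(1) y'] by simp
      have d2: "((\<lambda>t. \<Psi>1 ((t - p) / s) / s) has_real_derivative \<Psi>2 ((t - p) / s) / s / s) (at t)" for t
        using DERIV_cdivide[OF DERIV_chain2[OF \<Psi>(2) y'], of s] by simp
      show "continuous_on {p - R * s..p + R * s} (\<lambda>t. \<Psi> ((t - p) / s))"
        by (rule DERIV_imp_continuous_on[OF d1])
      show "0 < \<Psi> ((p - p) / s)" by (simp add: \<Psi>_def E_def v_def)
      show "\<Psi> ((p - R * s - p) / s) \<le> 0" "\<Psi> ((p + R * s - p) / s) \<le> 0"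
        using s R by (simp_all add: \<Psi>_def v_def)
      show "((\<lambda>t. \<Psi> ((t - p) / s)) has_real_derivative \<Psi>1 ((t - p) / s) / s) (at t)" for t
        by (rule d1)
      show "((\<lambda>t. \<Psi>1 ((t - p) / s) / s) has_real_derivative \<Psi>2 ((t - p) / s) / s / s) (at t)" for t
        by (rule d2)
      fix t assume t: "\<bar>t - p\<bar> < R * s"
      define y where "y = (t - p) / s"
      have ty: "t - p = s * y" using s by (simp add: y_def)
      have y: "\<bar>y\<bar> \<le> R" using t s by (simp add: y_def field_simps)
      have td: "\<bar>t - p\<bar> < d" using t Rs by simp
      have "\<bar>b t / s - \<beta> * y\<bar> = \<bar>b t - \<beta> * (t - p)\<bar> / s"
        using s by (simp add: ty field_simps flip: abs_div_pos)
      also have "\<dots> \<le> \<tau> * \<bar>t - p\<bar> / s" using near(3)[OF td] s by (simp add: divide_right_mono)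
      also have "\<dots> = \<tau> * \<bar>y\<bar>" using s by (simp add: ty abs_mult)
      also have "\<dots> \<le> \<tau> * R" using y \<tau> by simp
      finally have b1: "\<bar>b t / s - \<beta> * y\<bar> \<le> \<tau> * R" .
      have "\<bar>(a t - a0) * \<Psi>2 y\<bar> \<le> \<tau> * K" "\<bar>(c t - c p) * \<Psi> y\<bar> \<le> \<tau> * K"
        "\<bar>(b t / s - \<beta> * y) * \<Psi>1 y\<bar> \<le> \<tau> * R * K"
        unfolding abs_mult using near[OF td] \<Psi>K[OF y] b1 \<tau> R by (intro mult_mono; simp)+
      then have "- (\<tau> * K) \<le> (a t - a0) * \<Psi>2 y" "- (\<tau> * K) \<le> (c t - c p) * \<Psi> y"
        "- (\<tau> * R * K) \<le> (b t / s - \<beta> * y) * \<Psi>1 y"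
        by (simp_all only: abs_le_iff minus_le_iff)
      then have "- (\<tau> * K) + - (\<tau> * K) + - (\<tau> * R * K)
          \<le> (a t - a0) * \<Psi>2 y + (c t - c p) * \<Psi> y + (b t / s - \<beta> * y) * \<Psi>1 y"
        by (intro add_mono)
      also have "- (\<tau> * K) + - (\<tau> * K) + - (\<tau> * R * K) = - \<delta>"
        unfolding \<tau>(2)[symmetric] by (simp add: algebra_simps)
      finally have "0 \<le> ((a t - a0) * \<Psi>2 y + (c t - c p) * \<Psi> y + (b t / s - \<beta> * y) * \<Psi>1 y)
          + (a0 * \<Psi>2 y + \<beta> * y * \<Psi>1 y + (max 0 \<beta> + \<eta>) * \<Psi> y)"
        using main[OF y] by simp
      also have "\<dots> = a t * \<Psi>2 y + b t * (\<Psi>1 y / s) + c t * \<Psi> y - (c p - max 0 \<beta> - \<eta>) * \<Psi> y"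
        by (simp add: algebra_simps)
      also have "a t * \<Psi>2 y = \<epsilon> * a t * (\<Psi>2 y / s / s)"
        using s(1) by (simp add: field_simps flip: s(2))
      finally show "(c p - max 0 \<beta> - \<eta>) * \<Psi> ((t - p) / s)
          \<le> \<epsilon> * a t * (\<Psi>2 ((t - p) / s) / s / s) + b t * (\<Psi>1 ((t - p) / s) / s) + c t * \<Psi> ((t - p) / s)"
        by (simp add: y_def)
    qed
  qed
qed

subsection \<open>The upper bound\<close>

text \<open>The auxiliary \<open>H\<close> is one continuous positive function that equals
  \<open>Z\<close> wherever \<open>F \<ge> m\<close>. Its minimum \<open>z\<close> bounds the
  penalty below there, and \<open>z / \<epsilon>\<close> beats the maximal excess
  \<open>M\<close>.\<close>

lemma penalization:
  fixes F Z :: "real \<Rightarrow> real"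
  assumes F: "F \<in> Ck_circle 0" and Z: "Z \<in> Ck_circle 0" "\<And>t. Z t \<ge> 0"
    and less: "\<And>t. Z t = 0 \<Longrightarrow> F t < m"
  obtains \<epsilon>0 where "\<epsilon>0 > 0" "\<And>\<epsilon> t. 0 < \<epsilon> \<Longrightarrow> \<epsilon> < \<epsilon>0 \<Longrightarrow> F t - Z t / \<epsilon> \<le> m"
proof -
  define H where "H t = max (m - F t) 0 + Z t" for t
  have Z0: "Z t > 0" if "F t \<ge> m" for t
    using less[of t] Z(2)[of t] that by (metis less_eq_real_def not_less)
  have FC: "(\<lambda>t. F t - m) \<in> Ck_circle 0" "(\<lambda>t. m - F t) \<in> Ck_circle 0"
    by (intro Ck_circle_0_arith F Ck_circle_0_const)+
  have HC: "H \<in> Ck_circle 0"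
    unfolding H_def by (intro Ck_circle_0_arith FC Z Ck_circle_0_const)
  have "H t > 0" for t
    using Z0[of t] Z(2)[of t] unfolding H_def by (cases "F t \<ge> m") (auto simp: add_pos_nonneg)
  then obtain z where z: "z > 0" "\<And>t. z \<le> H t" using Ck_circle_0_pos_lower[OF HC] by metis
  obtain M where M: "M > 0" "\<And>t. \<bar>F t - m\<bar> \<le> M" using Ck_circle_0_bounded[OF FC(1)] by metis
  show ?thesis
  proof (rule that[of "z / M"])
    show "z / M > 0" using z M by simp
    fix \<epsilon> t assume \<epsilon>: "0 < \<epsilon>" "\<epsilon> < z / M"
    show "F t - Z t / \<epsilon> \<le> m"
    proof (cases "F t \<ge> m")
      case True
      then have "z \<le> Z t" using z(2)[of t] by (simp add: H_def)
      then have "\<epsilon> * M \<le> Z t" using \<epsilon> M by (simp add: field_simps)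
      then have "M \<le> Z t / \<epsilon>" using \<epsilon> by (simp add: field_simps)
      then show ?thesis using M(2)[of t] by (simp add: abs_le_iff)
    next
      case False
      then show ?thesis using Z(2)[of t] \<epsilon> by (smt (verit) divide_nonneg_pos)
    qed
  qed
qed

(* The supersolution exp (- Q / eps) with Q' = theta b / a: for theta = 1 the operator acts on it
   as multiplication by c - a (b / a)', for theta = 0 by c, and in between there is the additional
   penalty - theta (1 - theta) b^2 / (eps a). *)
lemma eigenvalue_upper_bound:
  fixes \<theta> :: "real \<Rightarrow> real"
  assumes a: "a \<in> Ck_circle 0" "\<And>t. a t > 0" "\<And>t. (a has_real_derivative a' t) (at t)" "a' \<in> Ck_circle 0"
    and b: "b \<in> Ck_circle 0" "\<And>t. (b has_real_derivative b' t) (at t)" "b' \<in> Ck_circle 0"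
    and c: "c \<in> Ck_circle 0"
    and \<theta>: "\<theta> \<in> Ck_circle 0" "\<And>t. (\<theta> has_real_derivative \<theta>' t) (at t)" "\<theta>' \<in> Ck_circle 0"
      "\<And>t. 0 \<le> \<theta> t" "\<And>t. \<theta> t \<le> 1" "\<And>t. \<theta> t = 0 \<or> \<theta> t = 1 \<Longrightarrow> b t = 0"
      "integral {0..1} (\<lambda>t. \<theta> t * b t / a t) = 0"
    and M: "\<And>t. b t = 0 \<Longrightarrow> c t - \<theta> t * b' t < M"
  shows "\<exists>\<epsilon>0>0. \<forall>\<epsilon> l \<phi> \<phi>' \<phi>''. 0 < \<epsilon> \<and> \<epsilon> < \<epsilon>0 \<and>
    positive_eigenfunction (\<lambda>t. \<epsilon> * a t) b c l \<phi> \<phi>' \<phi>'' \<longrightarrow> l \<le> M"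
proof -
  have a0: "a t \<noteq> 0" for t using a(2)[of t] by simp
  define q where "q t = \<theta> t * b t / a t" for t
  define q' where "q' t = (\<theta>' t * b t + \<theta> t * b' t) / a t - \<theta> t * b t * a' t / (a t * a t)" for t
  have q: "(q has_real_derivative q' t) (at t)" for t
    unfolding q_def[abs_def] q'_def using a0[of t]
    by (auto intro!: derivative_eq_intros \<theta> a b simp: field_simps)
  have qC: "q \<in> Ck_circle 0" unfolding q_def by (intro Ck_circle_0_arith \<theta> a b a0)
  have q'C: "q' \<in> Ck_circle 0" unfolding q'_def by (intro Ck_circle_0_arith \<theta> a b a0) (simp add: a0)
  obtain Q where Q: "\<And>t. (Q has_real_derivative q t) (at t)"
    using antiderivative_exists[of q] qC by (auto simp: Ck_circle_0_iff)
  have "(q has_integral Q 1 - Q 0) {0..1}"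
    by (rule fundamental_theorem_of_calculus)
      (auto simp: has_real_derivative_iff_has_vector_derivative[symmetric] intro: has_field_derivative_at_within[OF Q])
  then have Q01: "Q 1 = Q 0" using \<theta>(7) by (simp add: q_def[abs_def] integral_unique)
  have "periodic Q"
    unfolding periodic_def
  proof
    fix t
    have "((\<lambda>t. Q (t + 1) - Q t) has_real_derivative 0) (at t)" for t
      using Q[of "t + 1"] Q[of t] periodicD[of q t] qC
      by (auto intro!: derivative_eq_intros simp: DERIV_shift Ck_circle_0_iff)
    from DERIV_isconst_all[of "\<lambda>t. Q (t + 1) - Q t" t 0] this
    show "Q (t + 1) = Q t" using Q01 by simp
  qed
  define F where "F t = c t - a t * q' t" for t
  define Z where "Z t = \<theta> t * (1 - \<theta> t) * (b t * b t) / a t" for t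
  have FC: "F \<in> Ck_circle 0" unfolding F_def by (intro Ck_circle_0_arith c a q'C)
  have ZC: "Z \<in> Ck_circle 0" unfolding Z_def by (intro Ck_circle_0_arith \<theta> a b a0 Ck_circle_0_const)
  have Z0: "Z t \<ge> 0" for t
    unfolding Z_def using \<theta>(4,5)[of t] a(2)[of t] by simp
  \<comment> \<open>A vanishing penalty forces \<open>b = 0\<close>, directly or through
    \<open>\<theta> \<in> {0, 1}\<close>. There \<open>a q' = \<theta> b'\<close>, so
    \<open>F = c - \<theta> b'\<close>.\<close>
  have FM: "F t < M" if "Z t = 0" for t
  proof -
    have "b t = 0" using that \<theta>(6)[of t] a0[of t] by (auto simp: Z_def)
    then show ?thesis using M[of t] a0[of t] by (simp add: F_def q'_def)
  qed
  obtain \<epsilon>0 where \<epsilon>0: "\<epsilon>0 > 0" "\<And>\<epsilon> t. 0 < \<epsilon> \<Longrightarrow> \<epsilon> < \<epsilon>0 \<Longrightarrow> F t - Z t / \<epsilon> \<le> M"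
    using penalization[OF FC ZC Z0 FM] by metis
  show ?thesis
  proof (intro exI[of _ \<epsilon>0] conjI allI impI)
    show "\<epsilon>0 > 0" by (rule \<epsilon>0)
    fix \<epsilon> l :: real and \<phi> \<phi>' \<phi>''
    assume *: "0 < \<epsilon> \<and> \<epsilon> < \<epsilon>0 \<and> positive_eigenfunction (\<lambda>t. \<epsilon> * a t) b c l \<phi> \<phi>' \<phi>''"
    then have \<epsilon>: "\<epsilon> > 0" by simp
    define \<psi> where "\<psi> t = exp (- (Q t / \<epsilon>))" for t
    have d: "(\<psi> has_real_derivative - (q t / \<epsilon>) * \<psi> t) (at t)" for t
      unfolding \<psi>_def using \<epsilon> by (auto intro!: derivative_eq_intros Q)
    show "l \<le> M"
    proof (rule supersolution_bound[where \<psi> = \<psi> and \<psi>' = "\<lambda>t. - (q t / \<epsilon>) * \<psi> t" and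
          \<psi>'' = "\<lambda>t. (q t * q t / \<epsilon> - q' t) / \<epsilon> * \<psi> t"])
      show "0 < \<epsilon> * a t" for t using * a(2)[of t] by simp
      show "positive_eigenfunction (\<lambda>t. \<epsilon> * a t) b c l \<phi> \<phi>' \<phi>''" using * by simp
      show "periodic \<psi>" using \<open>periodic Q\<close> by (simp add: periodic_def \<psi>_def)
      show "0 < \<psi> t" for t by (simp add: \<psi>_def)
      show "(\<psi> has_real_derivative - (q t / \<epsilon>) * \<psi> t) (at t)" for t by (rule d)
      show "((\<lambda>t. - (q t / \<epsilon>) * \<psi> t) has_real_derivative (q t * q t / \<epsilon> - q' t) / \<epsilon> * \<psi> t) (at t)" for t
        using \<epsilon> by (auto intro!: derivative_eq_intros q d simp: field_simps)
      fix t
      have "a t * q t * q t - b t * q t = - Z t"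
        using a0[of t] by (simp add: q_def Z_def field_simps)
      then have e: "(a t * q t * q t - b t * q t) / \<epsilon> = - Z t / \<epsilon>" by simp
      have "\<epsilon> * a t * ((q t * q t / \<epsilon> - q' t) / \<epsilon> * \<psi> t) + b t * (- (q t / \<epsilon>) * \<psi> t) + c t * \<psi> t
          = ((a t * q t * q t - b t * q t) / \<epsilon> + F t) * \<psi> t"
        using \<epsilon> by (simp add: F_def field_simps)
      also have "\<dots> = (F t - Z t / \<epsilon>) * \<psi> t" unfolding e by simp
      also have "\<dots> \<le> M * \<psi> t"
        using \<epsilon>0(2)[of \<epsilon> t] * by (intro mult_right_mono) (auto simp: \<psi>_def)
      finally show "\<epsilon> * a t * ((q t * q t / \<epsilon> - q' t) / \<epsilon> * \<psi> t) + b t * (- (q t / \<epsilon>) * \<psi> t) + c t * \<psi> t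
          \<le> M * \<psi> t" .
    qed
  qed
qed

section \<open>Choice of the switching function\<close>

text \<open>As \<open>s\<close> grows, the weight tends to 1 where \<open>h > 0\<close> and to 0
  where \<open>h < 0\<close>, so by dominated convergence the integral approaches that of
  \<open>max h 0 / a\<close>, which is positive.\<close>

lemma weighted_integral_pos:
  fixes A B a h :: "real \<Rightarrow> real"
  assumes C: "A \<in> Ck_circle 0" "B \<in> Ck_circle 0" "a \<in> Ck_circle 0" "h \<in> Ck_circle 0"
    and a: "\<And>t. a t > 0" and AB: "\<And>t. A t \<ge> 0" "\<And>t. B t \<ge> 0" "\<And>t. A t > 0 \<or> B t > 0"
    and zero: "\<And>t. A t = 0 \<or> B t = 0 \<Longrightarrow> h t = 0" and pos: "h t0 > 0"
  obtains s where "integral {0..1} (\<lambda>t. B t / (A t * exp (- s * h t) + B t) * h t / a t) > 0"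
proof -
  define D where "D s t = A t * exp (- s * h t) + B t" for s t
  have D: "D s t > 0" for s t
    using AB[of t] unfolding D_def by (auto simp: add_nonneg_pos add_pos_nonneg)
  have cont: "continuous_on S A" "continuous_on S B" "continuous_on S a" "continuous_on S h" for S
    using C continuous_on_subset by (auto simp: Ck_circle_0_iff)
  define f where "f n t = B t / D (real n) t * h t / a t" for n t
  define g where "g t = max (h t) 0 / a t" for t
  have a0: "a t \<noteq> 0" for t using a[of t] by simp
  have D0: "D s t \<noteq> 0" for s t using D[of s t] by simp
  have "f n integrable_on {0..1}" for n
    unfolding f_def D_def
    by (intro integrable_continuous_real continuous_intros cont) (use a0 D0[of n] in \<open>auto simp: D_def\<close>)
  moreover have "(\<lambda>t. \<bar>h t\<bar> / a t) integrable_on {0..1}"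
    by (intro integrable_continuous_real continuous_intros cont) (use a0 in auto)
  moreover have "norm (f n t) \<le> \<bar>h t\<bar> / a t" for n t
  proof -
    have "B t / D n t \<le> 1" "0 \<le> B t / D n t"
      using AB[of t] D[of n t] by (auto simp: D_def)
    then have "B t / D n t * (\<bar>h t\<bar> / a t) \<le> 1 * (\<bar>h t\<bar> / a t)"
      using a[of t] by (intro mult_right_mono) auto
    then show ?thesis using a[of t] D[of n t] AB(2)[of t] by (simp add: f_def abs_mult)
  qed
  moreover have "(\<lambda>n. f n t) \<longlonglongrightarrow> g t" for t
  proof -
    consider "h t = 0" | "h t > 0" | "h t < 0" by linarith
    then show ?thesis
    proof cases
      case 1
      then show ?thesis by (simp add: f_def g_def)
    next
      case 2
      have "B t \<noteq> 0" using zero[of t] 2 by auto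
      moreover have "(\<lambda>n. exp (- real n * h t)) \<longlonglongrightarrow> 0" using 2 by real_asymp
      ultimately have "(\<lambda>n. B t / (A t * exp (- real n * h t) + B t) * h t / a t) \<longlonglongrightarrow>
          B t / (A t * 0 + B t) * h t / a t"
        by (intro tendsto_intros) (auto simp: a0)
      then show ?thesis using 2 \<open>B t \<noteq> 0\<close> by (simp add: f_def g_def D_def)
    next
      case 3
      have "A t > 0" using zero[of t] 3 AB(1)[of t] by (metis less_eq_real_def less_irrefl)
      then have "filterlim (\<lambda>n. A t * exp (- real n * h t) + B t) at_top sequentially"
        using 3 by real_asymp
      then have "(\<lambda>n. B t / (A t * exp (- real n * h t) + B t)) \<longlonglongrightarrow> 0"
        by (intro tendsto_divide_0[OF tendsto_const] filterlim_at_top_imp_at_infinity)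
      then have "(\<lambda>n. B t / (A t * exp (- real n * h t) + B t) * (h t / a t)) \<longlonglongrightarrow> 0"
        by (rule tendsto_mult_left_zero)
      then show ?thesis using 3 by (simp add: f_def g_def D_def)
    qed
  qed
  ultimately have lim: "(\<lambda>n. integral {0..1} (f n)) \<longlonglongrightarrow> integral {0..1} g"
    by (rule dominated_convergence(2))
  have "integral {0..1} g > 0"
  proof -
    have gC: "continuous_on {0..1} g" unfolding g_def by (intro continuous_intros cont) (use a0 in auto)
    have g0: "g t \<ge> 0" for t using a[of t] by (simp add: g_def)
    have "h (frac t0) = h t0" using C(4) by (simp add: periodic_frac Ck_circle_0_iff)
    then have "g (frac t0) > 0" using pos a[of "frac t0"] by (simp add: g_def)
    moreover have "frac t0 \<in> {0..1}" using frac_lt_1[of t0] by (simp add: less_imp_le)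
    ultimately have "integral {0..1} g \<noteq> 0"
      using integral_eq_0_iff[OF gC] g0 by force
    moreover have "integral {0..1} g \<ge> 0"
      by (intro integral_nonneg integrable_continuous_real gC) (use g0 in auto)
    ultimately show ?thesis by simp
  qed
  from order_tendstoD(1)[OF lim this]
  obtain n where "integral {0..1} (f n) > 0"
    using eventually_happens'[OF sequentially_bot] by blast
  then show ?thesis using that[of "real n"] by (simp add: f_def[abs_def] D_def)
qed

text \<open>Every member of the family \<open>B / (A exp (- s b) + B)\<close> takes the values 0 and
  1 at the prescribed places. The parameter \<open>s\<close> is free to annihilate the mean of
  \<open>\<theta> b / a\<close> by the intermediate value theorem.\<close>

lemma switching_function_exists:
  fixes A B a b :: "real \<Rightarrow> real"
  assumes A: "A \<in> Ck_circle 0" "\<And>t. (A has_real_derivative A' t) (at t)" "A' \<in> Ck_circle 0"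
    and B: "B \<in> Ck_circle 0" "\<And>t. (B has_real_derivative B' t) (at t)" "B' \<in> Ck_circle 0"
    and a: "a \<in> Ck_circle 0" "\<And>t. a t > 0"
    and b: "b \<in> Ck_circle 0" "\<And>t. (b has_real_derivative b' t) (at t)" "b' \<in> Ck_circle 0"
    and AB: "\<And>t. A t \<ge> 0" "\<And>t. B t \<ge> 0" "\<And>t. A t > 0 \<or> B t > 0"
    and zero: "\<And>t. A t = 0 \<or> B t = 0 \<Longrightarrow> b t = 0" and pos: "b t1 > 0" and neg: "b t2 < 0"
  obtains \<theta> \<theta>' where "\<theta> \<in> Ck_circle 0" "\<And>t. (\<theta> has_real_derivative \<theta>' t) (at t)" "\<theta>' \<in> Ck_circle 0"
      "\<And>t. 0 \<le> \<theta> t" "\<And>t. \<theta> t \<le> 1" "\<And>t. \<theta> t = 0 \<longleftrightarrow> B t = 0" "\<And>t. \<theta> t = 1 \<longleftrightarrow> A t = 0"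
      "integral {0..1} (\<lambda>t. \<theta> t * b t / a t) = 0"
proof -
  define I where "I s = integral {0..1} (\<lambda>t. B t / (A t * exp (- s * b t) + B t) * b t / a t)" for s
  have D: "A t * exp (- s * b t) + B t > 0" for s t
    using AB[of t] by (auto simp: add_nonneg_pos add_pos_nonneg)
  have a0: "a t \<noteq> 0" for t using a(2)[of t] by simp
  have D0: "A t * exp (- s * b t) + B t \<noteq> 0" for s t using D[of t s] by simp
  obtain s1 where s1: "I s1 > 0"
    using weighted_integral_pos[OF A(1) B(1) a(1) b(1) a(2) AB zero pos] unfolding I_def by metis
  have nb: "(\<lambda>t. - b t) \<in> Ck_circle 0"
    using Ck_circle_0_arith(2)[OF Ck_circle_0_const b(1), of 0] by simp
  \<comment> \<open>Passing to \<open>- b\<close> reverses both the integrand and the sign of the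
    parameter, hence the value at \<open>- s2\<close> below.\<close>
  obtain s2 where "integral {0..1} (\<lambda>t. B t / (A t * exp (- s2 * - b t) + B t) * - b t / a t) > 0"
    using weighted_integral_pos[OF A(1) B(1) a(1) nb a(2) AB _ , of t2] zero neg by auto
  then have s2: "I (- s2) < 0" by (simp add: I_def)
  have cont: "continuous_on S A" "continuous_on S B" "continuous_on S a" "continuous_on S b" for S
    using A(1) B(1) a(1) b(1) continuous_on_subset by (auto simp: Ck_circle_0_iff)
  have "continuous_on (UNIV \<times> cbox 0 1) (\<lambda>(s, t). B t / (A t * exp (- s * b t) + B t) * b t / a t)"
    unfolding split_beta
    by (intro continuous_intros continuous_on_compose2[OF cont(1)[of UNIV]]
        continuous_on_compose2[OF cont(2)[of UNIV]] continuous_on_compose2[OF cont(3)[of UNIV]]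
        continuous_on_compose2[OF cont(4)[of UNIV]]) (use a0 D0 in auto)
  from integral_continuous_on_param[OF this]
  have "continuous_on UNIV I" by (simp add: I_def[abs_def])
  then have "connected (range I)" by (rule connected_continuous_image) simp
  then have "0 \<in> range I"
    using s1 s2 by (intro connectedD_interval[of "range I" "I (- s2)" "I s1" 0]) auto
  then obtain s where s: "I s = 0" by auto
  define E where "E t = exp (- s * b t)" for t
  have E: "(E has_real_derivative - s * b' t * E t) (at t)" for t
    unfolding E_def by (auto intro!: derivative_eq_intros b)
  have EC: "E \<in> Ck_circle 0"
    using b(1) DERIV_imp_continuous_on[OF E] by (auto simp: Ck_circle_0_iff periodic_def E_def)
  define D where "D t = A t * E t + B t" for t
  define D' where "D' t = A' t * E t + A t * (- s * b' t * E t) + B' t" for t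
  have Dpos: "D t > 0" for t using D[of t s] by (simp add: D_def E_def)
  then have Dn: "D t \<noteq> 0" for t by (metis less_irrefl)
  have D': "(D has_real_derivative D' t) (at t)" for t
    unfolding D_def[abs_def] D'_def by (auto intro!: derivative_eq_intros A B E)
  have DC: "D \<in> Ck_circle 0" unfolding D_def by (intro Ck_circle_0_arith A B EC)
  have D'C: "D' \<in> Ck_circle 0"
    unfolding D'_def by (intro Ck_circle_0_arith A B EC b Ck_circle_0_const)
  show ?thesis
  proof (rule that[of "\<lambda>t. B t / D t" "\<lambda>t. (B' t * D t - B t * D' t) / (D t * D t)"])
    show "(\<lambda>t. B t / D t) \<in> Ck_circle 0" by (intro Ck_circle_0_arith B DC Dn)
    show "(\<lambda>t. (B' t * D t - B t * D' t) / (D t * D t)) \<in> Ck_circle 0"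
      by (intro Ck_circle_0_arith B DC D'C) (simp add: Dn)
    show "((\<lambda>t. B t / D t) has_real_derivative (B' t * D t - B t * D' t) / (D t * D t)) (at t)" for t
      by (intro DERIV_divide B D' Dn)
    fix t
    have E0: "E t > 0" by (simp add: E_def)
    show "0 \<le> B t / D t" using AB(2) Dpos by (simp add: less_imp_le)
    show "B t / D t \<le> 1" using AB(1)[of t] E0 Dpos[of t] by (simp add: D_def)
    show "B t / D t = 0 \<longleftrightarrow> B t = 0" using Dn by simp
    show "B t / D t = 1 \<longleftrightarrow> A t = 0" using Dn[of t] E0 by (auto simp: D_def)
    show "integral {0..1} (\<lambda>t. B t / D t * b t / a t) = 0" using s by (simp add: I_def D_def E_def)
  qed
qed

subsection \<open>The limit of the principal eigenvalue\<close>

lemma Ck_circle_1_real: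
  fixes f :: "real \<Rightarrow> real"
  assumes "f \<in> Ck_circle 1"
  shows "f \<in> Ck_circle 0" "\<And>t. (f has_real_derivative deriv f t) (at t)" "deriv f \<in> Ck_circle 0"
proof -
  note f = Ck_circle_1D[OF assms]
  have d: "(f has_real_derivative nderiv 1 f t) (at t)" for t
    using f(2) by (simp add: has_real_derivative_iff_has_vector_derivative)
  then have e: "deriv f = nderiv 1 f" by (auto intro: DERIV_imp_deriv)
  show "(f has_real_derivative deriv f t) (at t)" for t using d by (simp add: e)
  show "f \<in> Ck_circle 0" using f(1) DERIV_imp_continuous_on[OF d] by (simp add: Ck_circle_0_iff)
  show "deriv f \<in> Ck_circle 0"
    unfolding e using f(3) periodic_DERIV[OF f(1) d] by (simp add: Ck_circle_0_iff)
qed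

text \<open>The function \<open>sin (pi (t - x i))\<close> changes sign under a unit shift; squaring
  restores period 1 and gives nonnegativity. For empty \<open>I\<close> the product is 1, as wanted
  when there are no zeros of one kind.\<close>

lemma periodic_function_with_zeros_at:
  fixes x :: "nat \<Rightarrow> real"
  assumes "finite I"
  obtains P P' where "P \<in> Ck_circle 0" "\<And>t. (P has_real_derivative P' t) (at t)" "P' \<in> Ck_circle 0"
    "\<And>t. P t \<ge> 0" "\<And>t. P t = 0 \<longleftrightarrow> (\<exists>i\<in>I. t - x i \<in> \<int>)"
proof -
  define S where "S i t = sin ((t - x i) * pi)" for i t
  define P where "P t = (\<Prod>i\<in>I. (S i t)\<^sup>2)" for t
  have "sin ((t + 1 - x i) * pi) = - sin ((t - x i) * pi)" for t i
    using sin_periodic_pi[of "(t - x i) * pi"] by (simp add: algebra_simps)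
  then have per: "periodic P"
    by (simp add: periodic_def P_def S_def)
  have "\<exists>P'. continuous_on UNIV P' \<and> (\<forall>t. ((\<lambda>t. \<Prod>i\<in>I. (S i t)\<^sup>2) has_real_derivative P' t) (at t))"
    using assms
  proof (induction I rule: finite_induct)
    case empty
    then show ?case by (intro exI[of _ "\<lambda>_. 0"]) auto
  next
    case (insert j J)
    then obtain Q where Q: "continuous_on UNIV Q"
      "\<And>t. ((\<lambda>t. \<Prod>i\<in>J. (S i t)\<^sup>2) has_real_derivative Q t) (at t)" by auto
    have S': "((\<lambda>t. (S j t)\<^sup>2) has_real_derivative 2 * S j t * cos ((t - x j) * pi) * pi) (at t)" for t
      unfolding S_def by (auto intro!: derivative_eq_intros)
    show ?case
    proof (intro exI conjI allI)
      show "((\<lambda>t. \<Prod>i\<in>insert j J. (S i t)\<^sup>2) has_real_derivative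
        (2 * S j t * cos ((t - x j) * pi) * pi) * (\<Prod>i\<in>J. (S i t)\<^sup>2) + Q t * (S j t)\<^sup>2) (at t)" for t
        unfolding prod.insert[OF insert.hyps] by (rule DERIV_mult[OF S' Q(2)])
      show "continuous_on UNIV (\<lambda>t. (2 * S j t * cos ((t - x j) * pi) * pi) * (\<Prod>i\<in>J. (S i t)\<^sup>2) + Q t * (S j t)\<^sup>2)"
        unfolding S_def by (intro continuous_intros Q)
    qed
  qed
  then obtain P' where P': "continuous_on UNIV P'" "\<And>t. (P has_real_derivative P' t) (at t)"
    by (auto simp: P_def[abs_def])
  show ?thesis
  proof (rule that[of P P'])
    show "P \<in> Ck_circle 0" using per DERIV_imp_continuous_on[OF P'(2)] by (simp add: Ck_circle_0_iff)
    show "P' \<in> Ck_circle 0" using P' periodic_DERIV[OF per P'(2)] by (simp add: Ck_circle_0_iff)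
    show "(P has_real_derivative P' t) (at t)" for t by (rule P')
    show "P t \<ge> 0" for t unfolding P_def by (intro prod_nonneg) simp
    show "P t = 0 \<longleftrightarrow> (\<exists>i\<in>I. t - x i \<in> \<int>)" for t
      using assms by (auto simp: P_def S_def sin_times_pi_eq_0)
  qed
qed

text \<open>The lower bound is used at one zero attaining the maximum, the upper bound for all zeros
  at once. \<open>A\<close> vanishes at the zeros with positive derivative and \<open>B\<close> at
  the others, so that \<open>\<theta> b' = max 0 b'\<close> at every zero of
  \<open>b\<close>.\<close>

lemma principal_eigenvalue_tendsto:
  fixes a b c :: "real \<Rightarrow> real" and x :: "nat \<Rightarrow> real"
  assumes a: "a \<in> Ck_circle 1" "\<And>t. a t > 0" and b: "b \<in> Ck_circle 1" and c: "c \<in> Ck_circle 0"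
    and pos: "\<exists>t. b t > 0" and neg: "\<exists>t. b t < 0"
    and x: "bij_betw x {1..n} {t \<in> {0..<1}. b t = 0}" and n: "n \<ge> 1"
  shows "(principal_eigenvalue a b c \<longlongrightarrow> (MAX i\<in>{1..n}. c (x i) - max 0 (deriv b (x i)))) (at_right 0)"
proof (rule tendstoI)
  fix e :: real assume e: "0 < e"
  define v where "v i = c (x i) - max 0 (deriv b (x i))" for i
  define M where "M = Max (v ` {1..n})"
  note a1 = Ck_circle_1_real[OF a(1)] and b1 = Ck_circle_1_real[OF b]
  have v_le: "v i \<le> M" if "i \<in> {1..n}" for i
    unfolding M_def using that by (intro Max_ge) auto
  have "M \<in> v ` {1..n}" unfolding M_def using n by (intro Max_in) auto
  then obtain j where j: "j \<in> {1..n}" "M = v j" by auto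
  have bx: "b (x i) = 0" "x i \<in> {0..<1}" if "i \<in> {1..n}" for i
    using bij_betwE[OF x] that by auto
  have zeros: "b t = 0 \<longleftrightarrow> (\<exists>i\<in>{1..n}. t - x i \<in> \<int>)" for t
  proof
    assume t: "b t = 0"
    have "frac t \<in> {t \<in> {0..<1}. b t = 0}"
      using t b1(1) frac_lt_1[of t] by (simp add: periodic_frac Ck_circle_0_iff)
    then have "frac t \<in> x ` {1..n}" using x by (simp only: bij_betw_def)
    then obtain i where "i \<in> {1..n}" "x i = frac t" by (metis imageE)
    then show "\<exists>i\<in>{1..n}. t - x i \<in> \<int>" by (intro bexI[of _ i]) (simp_all add: frac_def)
  next
    assume "\<exists>i\<in>{1..n}. t - x i \<in> \<int>"
    then obtain i k where i: "i \<in> {1..n}" and k: "t = x i + of_int k"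
      by (metis Ints_cases add.commute diff_add_cancel)
    then show "b t = 0" using bx(1)[OF i] b1(1) by (simp add: periodic_add_int Ck_circle_0_iff)
  qed
  define U where "U = {i \<in> {1..n}. deriv b (x i) > 0}"
  define W where "W = {i \<in> {1..n}. deriv b (x i) \<le> 0}"
  have fin: "finite U" "finite W" by (auto simp: U_def W_def)
  obtain A A' where A: "A \<in> Ck_circle 0" "\<And>t. (A has_real_derivative A' t) (at t)" "A' \<in> Ck_circle 0"
    "\<And>t. A t \<ge> 0" "\<And>t. A t = 0 \<longleftrightarrow> (\<exists>i\<in>U. t - x i \<in> \<int>)"
    using periodic_function_with_zeros_at[OF fin(1)] by metis
  obtain B B' where B: "B \<in> Ck_circle 0" "\<And>t. (B has_real_derivative B' t) (at t)" "B' \<in> Ck_circle 0"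
    "\<And>t. B t \<ge> 0" "\<And>t. B t = 0 \<longleftrightarrow> (\<exists>i\<in>W. t - x i \<in> \<int>)"
    using periodic_function_with_zeros_at[OF fin(2)] by metis
  have shift: "g t = g (x i)" if "g \<in> Ck_circle 0" "t - x i \<in> \<int>" for g :: "real \<Rightarrow> real" and t i
    using that periodic_add_int[of g "x i"] unfolding Ck_circle_0_iff
    by (metis Ints_cases add.commute diff_add_cancel)
  have AU: "deriv b t > 0" if "A t = 0" for t
    using that A(5)[of t] shift[OF b1(3)] by (auto simp: U_def)
  have BW: "deriv b t \<le> 0" if "B t = 0" for t
    using that B(5)[of t] shift[OF b1(3)] by (auto simp: W_def)
  \<comment> \<open>The sign of \<open>deriv b\<close> separates the two kinds of zeros, so
    \<open>A\<close> and \<open>B\<close> have none in common.\<close>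
  have AB: "A t > 0 \<or> B t > 0" for t
    using AU[of t] BW[of t] A(4)[of t] B(4)[of t] by (auto simp: less_le)
  have zero: "b t = 0" if "A t = 0 \<or> B t = 0" for t
    using that A(5)[of t] B(5)[of t] by (auto simp: zeros U_def W_def)
  obtain t1 t2 where t12: "b t1 > 0" "b t2 < 0" using pos neg by auto
  obtain \<theta> \<theta>' where \<theta>: "\<theta> \<in> Ck_circle 0" "\<And>t. (\<theta> has_real_derivative \<theta>' t) (at t)" "\<theta>' \<in> Ck_circle 0"
      "\<And>t. 0 \<le> \<theta> t" "\<And>t. \<theta> t \<le> 1" "\<And>t. \<theta> t = 0 \<longleftrightarrow> B t = 0" "\<And>t. \<theta> t = 1 \<longleftrightarrow> A t = 0"
      "integral {0..1} (\<lambda>t. \<theta> t * b t / a t) = 0"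
    by (rule switching_function_exists[OF A(1-3) B(1-3) a1(1) a(2) b1 A(4) B(4) AB zero t12], assumption)
      (rule that; simp)
  have \<theta>0: "b t = 0" if "\<theta> t = 0 \<or> \<theta> t = 1" for t using that zero \<theta>(6,7) by blast
  have less: "c t - \<theta> t * deriv b t < M + e / 2" if "b t = 0" for t
  proof -
    from zeros[THEN iffD1, OF that]
    obtain i where i: "i \<in> {1..n}" "t - x i \<in> \<int>" by blast
    have eq: "c t = c (x i)" "deriv b t = deriv b (x i)"
      by (rule shift[OF c i(2)], rule shift[OF b1(3) i(2)])
    have "\<theta> t * deriv b t = max 0 (deriv b (x i))"
    proof (cases "deriv b (x i) > 0")
      case True
      then have "A t = 0" using i A(5) by (auto simp: U_def)
      then show ?thesis using True \<theta>(7)[of t] by (simp add: eq)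
    next
      case False
      then have "B t = 0" using i B(5) by (auto simp: W_def)
      then show ?thesis using False \<theta>(6)[of t] by simp
    qed
    then show ?thesis using v_le[OF i(1)] e by (simp add: eq v_def)
  qed
  have "\<exists>\<epsilon>0>0. \<forall>\<epsilon> l \<phi> \<phi>' \<phi>''. 0 < \<epsilon> \<and> \<epsilon> < \<epsilon>0 \<and>
      positive_eigenfunction (\<lambda>t. \<epsilon> * a t) b c l \<phi> \<phi>' \<phi>'' \<longrightarrow> l \<le> M + e / 2"
    by (rule eigenvalue_upper_bound[OF a1(1) a(2) a1(2,3) b1 c \<theta>(1-5) _ \<theta>(8)]) (fact \<theta>0 less)+
  then obtain \<epsilon>1 where \<epsilon>1: "\<epsilon>1 > 0" "\<And>\<epsilon> l \<phi> \<phi>' \<phi>''. 0 < \<epsilon> \<Longrightarrow> \<epsilon> < \<epsilon>1 \<Longrightarrow>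
      positive_eigenfunction (\<lambda>t. \<epsilon> * a t) b c l \<phi> \<phi>' \<phi>'' \<Longrightarrow> l \<le> M + e / 2"
    by blast
  have e2: "e / 2 > 0" using e by simp
  obtain \<epsilon>2 where \<epsilon>2: "\<epsilon>2 > 0" "\<And>\<epsilon> l \<phi> \<phi>' \<phi>''. 0 < \<epsilon> \<Longrightarrow> \<epsilon> < \<epsilon>2 \<Longrightarrow>
      positive_eigenfunction (\<lambda>t. \<epsilon> * a t) b c l \<phi> \<phi>' \<phi>'' \<Longrightarrow> M - e / 2 \<le> l"
    using eigenvalue_lower_bound[OF a1(1) a(2) c b1(2) bx(1)[OF j(1)] e2] unfolding j(2) v_def by blast
  have "dist (principal_eigenvalue a b c \<epsilon>) M < e" if \<epsilon>: "0 < \<epsilon>" "\<epsilon> < min \<epsilon>1 \<epsilon>2" for \<epsilon>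
  proof -
    have "(\<lambda>t. \<epsilon> * a t) \<in> Ck_circle 0" by (intro Ck_circle_0_arith a1 Ck_circle_0_const)
    moreover have "\<epsilon> * a t > 0" for t using \<epsilon> a(2) by simp
    ultimately obtain l \<phi> \<phi>' \<phi>'' where ef: "positive_eigenfunction (\<lambda>t. \<epsilon> * a t) b c l \<phi> \<phi>' \<phi>''"
      by (rule positive_eigenfunction_exists[OF _ _ b1(1) c])
    then have "principal_eigenvalue a b c \<epsilon> = l"
      by (rule principal_eigenvalue_eqI[OF a1(1) a(2) b1(1) \<epsilon>(1)])
    then show ?thesis
      using \<epsilon>1(2)[OF \<epsilon>(1) _ ef] \<epsilon>2(2)[OF \<epsilon>(1) _ ef] \<epsilon>(2) e by (simp add: dist_real_def abs_less_iff)
  qed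
  then show "\<forall>\<^sub>F \<epsilon> in at_right 0. dist (principal_eigenvalue a b c \<epsilon>)
      (MAX i\<in>{1..n}. c (x i) - max 0 (deriv b (x i))) < e"
    unfolding eventually_at_right_field M_def v_def using \<epsilon>1(1) \<epsilon>2(1)
    by (intro exI[of _ "min \<epsilon>1 \<epsilon>2"]) auto
qed

section \<open>Integration against the Dirac sum and the supremum\<close>

text \<open>The complement of the atoms is null, so \<open>c\<close> may be replaced by the simple
  function \<open>g\<close>. Injectivity of \<open>x\<close> keeps the atoms apart, so that the mass
  at \<open>x j\<close> is \<open>w j\<close> alone.\<close>

lemma integral_dirac_sum:
  fixes c :: "real \<Rightarrow> real"
  assumes x: "inj_on x {1..n}" "\<And>i. i \<in> {1..n} \<Longrightarrow> x i \<in> {0..<1}"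
    and w: "\<And>i. i \<in> {1..n} \<Longrightarrow> 0 \<le> w i" "(\<Sum>i=1..n. w i) = 1"
    and c: "continuous_on UNIV c"
  shows "(\<integral>t. c t \<partial>dirac_sum n w x) = (\<Sum>i=1..n. w i * c (x i))"
proof -
  define \<mu> where "\<mu> = dirac_sum n w x"
  interpret prob_space \<mu> unfolding \<mu>_def by (rule prob_space_dirac_sum[OF x(2) w])
  have sets: "sets \<mu> = sets circle_borel" and space: "space \<mu> = {0..<1}"
    by (simp_all add: \<mu>_def sets_dirac_sum space_dirac_sum)
  have pt: "{x i} \<in> sets circle_borel" if "i \<in> {1..n}" for i
    using x(2)[OF that] by (auto simp: circle_borel_def sets_restrict_space_iff)
  have m: "measure \<mu> {x j} = w j" if j: "j \<in> {1..n}" for j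
  proof -
    have "emeasure \<mu> {x j} = (\<Sum>i=1..n. ennreal (w i) * emeasure (return circle_borel (x i)) {x j})"
      unfolding \<mu>_def by (rule emeasure_dirac_sum[OF pt[OF j]])
    also have "\<dots> = (\<Sum>i=1..n. if i = j then ennreal (w i) else 0)"
      using j pt[OF j] inj_onD[OF x(1)] by (intro sum.cong) (auto simp: indicator_def)
    also have "\<dots> = ennreal (w j)" using j by simp
    finally show ?thesis using w(1)[OF j] by (simp add: measure_def)
  qed
  define X where "X = {0..<1} - x ` {1..n}"
  have XS: "X \<in> sets circle_borel"
    unfolding X_def circle_borel_def by (auto simp: sets_restrict_space_iff finite_imp_closed borel_closed)
  have "emeasure \<mu> X = 0"
    unfolding \<mu>_def emeasure_dirac_sum[OF XS] using XS by (auto simp: X_def)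
  then have AE: "AE t in \<mu>. t \<in> x ` {1..n}"
    using XS by (intro AE_I[of _ _ X]) (auto simp: X_def space sets)
  have cm: "c \<in> borel_measurable \<mu>"
  proof -
    have "c \<in> borel_measurable circle_borel"
      unfolding circle_borel_def by (intro measurable_restrict_space1 borel_measurable_continuous_onI c)
    then show ?thesis by (subst measurable_cong_sets[OF sets refl])
  qed
  define g where "g t = (\<Sum>i=1..n. c (x i) * indicator {x i} t)" for t
  have gm: "g \<in> borel_measurable \<mu>"
    unfolding g_def using pt by (intro borel_measurable_sum borel_measurable_times borel_measurable_indicator) (auto simp: sets)
  have "g (x j) = c (x j)" if j: "j \<in> {1..n}" for j
  proof -
    have "g (x j) = (\<Sum>i=1..n. if i = j then c (x i) else 0)"
      unfolding g_def using inj_onD[OF x(1)] j by (intro sum.cong) (auto simp: indicator_def)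
    then show ?thesis using j by simp
  qed
  then have "AE t in \<mu>. c t = g t" using AE by (auto elim!: eventually_mono)
  then have "(\<integral>t. c t \<partial>\<mu>) = (\<integral>t. g t \<partial>\<mu>)" by (rule integral_cong_AE[OF cm gm])
  also have "\<dots> = (\<Sum>i=1..n. \<integral>t. c (x i) * indicator {x i} t \<partial>\<mu>)"
    unfolding g_def using pt
    by (intro Bochner_Integration.integral_sum integrable_mult_right integrable_real_indicator)
      (auto simp: sets emeasure_eq_measure)
  also have "\<dots> = (\<Sum>i=1..n. w i * c (x i))"
    using x(2) m by (intro sum.cong) (auto simp: space)
  finally show ?thesis by (simp add: \<mu>_def)
qed

theorem proposition4p20:
  fixes a b :: "real \<Rightarrow> real" and n :: nat and x w :: "nat \<Rightarrow> real"
  assumes "a \<in> Ck_circle 2" and "\<And>t. a t > 0"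
    and "b \<in> Ck_circle 1"
    and "\<exists>t. b t > 0" and "\<exists>t. b t < 0"
    and "bij_betw x {1..n} {t \<in> {0..<1}. b t = 0}"
    and "\<And>i. i \<in> {1..n} \<Longrightarrow> (\<exists>m. finite_order_zero b m (x i)) \<or> flat_zero b (x i)"
    and "\<And>i. i \<in> {1..n} \<Longrightarrow> w i \<ge> 0" and "(\<Sum>i=1..n. w i) = 1"
  shows "J a b (dirac_sum n w x) = ereal (\<Sum>i=1..n. w i * max 0 (deriv b (x i)))"
proof -
  define v where "v c i = c (x i) - max 0 (deriv b (x i))" for c i
  define r where "r = (\<Sum>i=1..n. w i * max 0 (deriv b (x i)))"
  have n: "n \<ge> 1" using assms(9) by (cases n) auto
  note x = assms(6) and w = assms(8,9)
  have xs: "inj_on x {1..n}" "\<And>i. i \<in> {1..n} \<Longrightarrow> x i \<in> {0..<1}"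
    using x bij_betwE[OF x] by (auto simp: bij_betw_def)
  have \<Lambda>: "limit_eigenvalue a b c = Max (v c ` {1..n})" if "c \<in> Ck_circle 0" for c
    unfolding limit_eigenvalue_def v_def
    by (intro tendsto_Lim principal_eigenvalue_tendsto Ck_circle_2D assms that n) simp
  have I: "(\<integral>t. c t \<partial>dirac_sum n w x) = (\<Sum>i=1..n. w i * c (x i))" if "c \<in> Ck_circle 0" for c
    using that by (intro integral_dirac_sum xs w) (simp_all add: Ck_circle_0_iff)
  have le: "(\<integral>t. c t \<partial>dirac_sum n w x) - limit_eigenvalue a b c \<le> r" if c: "c \<in> Ck_circle 0" for c
  proof -
    have "(\<Sum>i=1..n. w i * v c i) \<le> (\<Sum>i=1..n. w i * Max (v c ` {1..n}))"
      by (intro sum_mono mult_left_mono w Max_ge) auto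
    also have "\<dots> = Max (v c ` {1..n})" using w(2) by (simp flip: sum_distrib_right)
    finally show ?thesis
      by (simp add: I[OF c] \<Lambda>[OF c] r_def v_def algebra_simps sum_subtractf)
  qed
  define c where "c t = max 0 (deriv b t)" for t
  have c: "c \<in> Ck_circle 0"
    unfolding c_def by (intro Ck_circle_0_arith Ck_circle_0_const Ck_circle_1_real(3) assms)
  \<comment> \<open>For this \<open>c\<close> the limit eigenvalue is 0, and the integral alone
    accounts for the claimed value.\<close>
  have "v c ` {1..n} = {0}" using n by (auto simp: v_def c_def)
  then have "(\<integral>t. c t \<partial>dirac_sum n w x) - limit_eigenvalue a b c = r"
    unfolding I[OF c] \<Lambda>[OF c] by (simp add: r_def c_def)
  then show ?thesis
    unfolding J_def r_def[symmetric]
    by (intro antisym SUP_least SUP_upper2[OF c]) (simp_all add: le)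
qed

end
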